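(* Let $R$ be a (unital, commutative) $*$-algebra equipped with a submultiplicative $*$-seminorm $\varphi$, let $d\ge1$ be an integer, and let $S$ be a $\sum H(R)^{2d}$-module of $H(R)$, where $H(R)=\{a\in R:a^*=a\}$. Then the closure of $S$ in $H(R)$ with respect to $\varphi$ (restricted to $H(R)$) satisfies $$\overline{S}^{\varphi}=\mathrm{Pos}(\mathcal{K}_S\cap\mathfrak{sp}(\varphi)).$$ If $L:R\to\mathbb{C}$ is any $\varphi$-continuous $*$-linear functional such that $L(s)\ge0$ for all $s\in S$, then there exists a unique Radon measure $\mu$ on $\mathcal{X}(R)$ such that $L(a)=\int\hat a\,d\mu$ for all $a\in R$. Moreover, $\mathrm{supp}(\mu)\subseteq\mathcal{K}_S\cap\mathfrak{sp}(\varphi)$.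
   Context: A $*$-algebra is a unital commutative $\mathbb{C}$-algebra $R$ with an involution $*:R\to R$ satisfying $(\lambda a)^*=\overline{\lambda}a^*$, $(a+b)^*=a^*+b^*$, $(ab)^*=a^*b^*$, $a^{**}=a$ for $\lambda\in\mathbb{C}$, $a,b\in R$. A submultiplicative $*$-seminorm is a map $\varphi:R\to[0,\infty)$ with $\varphi(\lambda a)=|\lambda|\varphi(a)$, $\varphi(a+b)\le\varphi(a)+\varphi(b)$, $\varphi(ab)\le\varphi(a)\varphi(b)$, $\varphi(a^* )=\varphi(a)$ for $\lambda\in\mathbb{C}$, $a,b\in R$. $H(R)$ is a commutative unital $\mathbb{R}$-algebra and $R=H(R)\oplus iH(R)$. $\mathcal{X}(R)$ is the set of all (unital) $*$-algebra homomorphisms $\alpha:R\to\mathbb{C}$ (with $\alpha(a^* )=\overline{\alpha(a)}$), with the topology induced from the product topology on $\mathbb{C}^R$; $\hat a(\alpha)=\alpha(a)$ for $a\in R$. $\mathfrak{sp}(\varphi)$ is the subspace of all $\varphi$-continuous $\alpha\in\mathcal{X}(R)$. (Restriction to $H(R)$ identifies $\mathcal{X}(R)$ with the space of unital $\mathbb{R}$-algebra homomorphisms $H(R)\to\mathbb{R}$.) A $*$-linear functional is a $\mathbb{C}$-linear map $L:R\to\mathbb{C}$ with $L(a^* )=\overline{L(a)}$. A $\sum H(R)^{2d}$-module of $H(R)$ is a subset $S\subseteq H(R)$ with $1\in S$, $S+S\subseteq S$ and $a^{2d}\cdot S\subseteq S$ for all $a\in H(R)$. $\mathcal{K}_S:=\{\alpha\in\mathcal{X}(R):\alpha(s)\ge0\text{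 for all }s\in S\}$; for $K\subseteq\mathcal{X}(R)$, $\mathrm{Pos}(K):=\{a\in H(R):\alpha(a)\ge0\text{ for all }\alpha\in K\}$. A Radon measure on a Hausdorff space is a (positive) measure on its Borel $\sigma$-algebra that is locally finite (every point has a neighbourhood of finite measure) and inner regular (the measure of each Borel set is the supremum of the measures of its compact subsets). Writing $L(a)=\int\hat a\,d\mu$ includes that $\hat a$ is $\mu$-integrable. *)

theory Defs
  imports "HOL-Analysis.Analysis"
begin

(* A unital commutative complex algebra with involution. The sort {comm_ring, comm_monoid_mult}
   is used instead of comm_ring_1 because the latter excludes the zero ring (0 = 1). *)
locale star_algebra = vector_space scaleC
  for scaleC :: "complex \<Rightarrow> 'a::{comm_ring, comm_monoid_mult} \<Rightarrow> 'a" +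
  fixes star :: "'a \<Rightarrow> 'a"
  assumes scaleC_mult_left: "scaleC c a * b = scaleC c (a * b)"
    and star_scaleC: "star (scaleC c a) = scaleC (cnj c) (star a)"
    and star_add: "star (a + b) = star a + star b"
    and star_mult: "star (a * b) = star a * star b"
    and star_star: "star (star a) = a"

definition submult_star_seminorm ::
  "(complex \<Rightarrow> 'a::{comm_ring, comm_monoid_mult} \<Rightarrow> 'a) \<Rightarrow> ('a \<Rightarrow> 'a) \<Rightarrow> ('a \<Rightarrow> real) \<Rightarrow> bool"
  where "submult_star_seminorm scaleC star \<phi> \<longleftrightarrow>
    (\<forall>a. 0 \<le> \<phi> a) \<and>
    (\<forall>c a. \<phi> (scaleC c a) = cmod c * \<phi> a) \<and>
    (\<forall>a b. \<phi> (a + b) \<le> \<phi> a + \<phi> b) \<and>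
    (\<forall>a b. \<phi> (a * b) \<le> \<phi> a * \<phi> b) \<and>
    (\<forall>a. \<phi> (star a) = \<phi> a)"

definition seminorm_topology :: "('a::ab_group_add \<Rightarrow> real) \<Rightarrow> 'a topology"
  where "seminorm_topology \<phi> =
    topology (\<lambda>U. \<forall>x\<in>U. \<exists>e>0. \<forall>y. \<phi> (y - x) < e \<longrightarrow> y \<in> U)"

lemma openin_seminorm_topology:
  "openin (seminorm_topology \<phi>) U \<longleftrightarrow> (\<forall>x\<in>U. \<exists>e>0. \<forall>y. \<phi> (y - x) < e \<longrightarrow> y \<in> U)"
proof -
  let ?P = "\<lambda>U. \<forall>x\<in>U. \<exists>e>0. \<forall>y. \<phi> (y - x) < e \<longrightarrow> y \<in> U"
  have "?P (A \<inter> B)" if A: "?P A" and B: "?P B" for A B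
  proof
    fix x assume x: "x \<in> A \<inter> B"
    obtain e where e: "e > 0" "\<forall>y. \<phi> (y - x) < e \<longrightarrow> y \<in> A" using A x by blast
    obtain e' where e': "e' > 0" "\<forall>y. \<phi> (y - x) < e' \<longrightarrow> y \<in> B" using B x by blast
    show "\<exists>e>0. \<forall>y. \<phi> (y - x) < e \<longrightarrow> y \<in> A \<inter> B"
      using e e' by (intro exI[of _ "min e e'"]) auto
  qed
  moreover have "?P (\<Union>\<K>)" if "\<forall>K\<in>\<K>. ?P K" for \<K>
    using that by (meson UnionE UnionI)
  ultimately have "istopology ?P"
    unfolding istopology_def by blast
  then show ?thesis
    by (simp add: seminorm_topology_def topology_inverse')
qed

definition hermitian :: "('a \<Rightarrow> 'a) \<Rightarrow> 'a set"
  where "hermitian star = {a. star a = a}"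

definition star_linear ::
  "(complex \<Rightarrow> 'a::ab_group_add \<Rightarrow> 'a) \<Rightarrow> ('a \<Rightarrow> 'a) \<Rightarrow> ('a \<Rightarrow> complex) \<Rightarrow> bool"
  where "star_linear scaleC star L \<longleftrightarrow>
    Vector_Spaces.linear scaleC (*) L \<and> (\<forall>a. L (star a) = cnj (L a))"

definition characters ::
  "(complex \<Rightarrow> 'a::{comm_ring, comm_monoid_mult} \<Rightarrow> 'a) \<Rightarrow> ('a \<Rightarrow> 'a) \<Rightarrow> ('a \<Rightarrow> complex) set"
  where "characters scaleC star =
    {\<alpha>. star_linear scaleC star \<alpha> \<and> (\<forall>a b. \<alpha> (a * b) = \<alpha> a * \<alpha> b) \<and> \<alpha> 1 = 1}"

(* The ambient euclidean topology on 'a => complex is the product topology. *)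
definition character_space ::
  "(complex \<Rightarrow> 'a::{comm_ring, comm_monoid_mult} \<Rightarrow> 'a) \<Rightarrow> ('a \<Rightarrow> 'a) \<Rightarrow> ('a \<Rightarrow> complex) topology"
  where "character_space scaleC star = top_of_set (characters scaleC star)"

definition gelfand_spectrum ::
  "(complex \<Rightarrow> 'a::{comm_ring, comm_monoid_mult} \<Rightarrow> 'a) \<Rightarrow> ('a \<Rightarrow> 'a) \<Rightarrow> ('a \<Rightarrow> real)
    \<Rightarrow> ('a \<Rightarrow> complex) set"
  where "gelfand_spectrum scaleC star \<phi> =
    {\<alpha> \<in> characters scaleC star. continuous_map (seminorm_topology \<phi>) euclidean \<alpha>}"

definition power_module ::
  "('a::{comm_ring, comm_monoid_mult} \<Rightarrow> 'a) \<Rightarrow> nat \<Rightarrow> 'a set \<Rightarrow> bool"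
  where "power_module star d S \<longleftrightarrow>
    S \<subseteq> hermitian star \<and> 1 \<in> S \<and>
    (\<forall>s\<in>S. \<forall>t\<in>S. s + t \<in> S) \<and>
    (\<forall>a\<in>hermitian star. \<forall>s\<in>S. a ^ (2 * d) * s \<in> S)"

definition nonneg_characters ::
  "(complex \<Rightarrow> 'a::{comm_ring, comm_monoid_mult} \<Rightarrow> 'a) \<Rightarrow> ('a \<Rightarrow> 'a) \<Rightarrow> 'a set
    \<Rightarrow> ('a \<Rightarrow> complex) set"
  where "nonneg_characters scaleC star S =
    {\<alpha> \<in> characters scaleC star. \<forall>s\<in>S. \<alpha> s \<in> \<real>\<^sub>\<ge>\<^sub>0}"

definition Pos :: "('a \<Rightarrow> 'a) \<Rightarrow> ('a \<Rightarrow> complex) set \<Rightarrow> 'a set"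
  where "Pos star K = {a \<in> hermitian star. \<forall>\<alpha>\<in>K. \<alpha> a \<in> \<real>\<^sub>\<ge>\<^sub>0}"

definition radon_measure :: "'x topology \<Rightarrow> 'x measure \<Rightarrow> bool"
  where "radon_measure T M \<longleftrightarrow>
    Hausdorff_space T \<and>
    space M = topspace T \<and>
    sets M = sigma_sets (topspace T) {U. openin T U} \<and>
    (\<forall>x\<in>topspace T. \<exists>U. openin T U \<and> x \<in> U \<and> emeasure M U < \<infinity>) \<and>
    (\<forall>B\<in>sets M. emeasure M B = (SUP K\<in>{K. compactin T K \<and> K \<subseteq> B}. emeasure M K))"

definition measure_support :: "'x topology \<Rightarrow> 'x measure \<Rightarrow> 'x set"
  where "measure_support T M =
    {x \<in> topspace T. \<forall>U. openin T U \<and> x \<in> U \<longrightarrow> emeasure M U > 0}"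

definition represents :: "('a \<Rightarrow> complex) measure \<Rightarrow> ('a \<Rightarrow> complex) \<Rightarrow> bool"
  where "represents M L \<longleftrightarrow>
    (\<forall>a. integrable M (\<lambda>\<alpha>. \<alpha> a) \<and> L a = (\<integral>\<alpha>. \<alpha> a \<partial>M))"

end

theory Submission
  imports Defs
begin

text \<open>The theorem has an algebraic half, which identifies the closure \<open>M\<close> of \<open>S\<close>, and a
measure-theoretic half, which represents functionals that are nonnegative on \<open>M\<close>.

For the algebraic half, let \<open>T\<close> be the set of hermitian elements that multiply \<open>M\<close> into itself.
It is a closed set, it is stable under sums and products, and it contains all \<open>2d\<close>-th powers. The
seminorm makes \<open>T\<close> archimedean: for hermitian \<open>x\<close> of small seminorm, \<open>1 + x\<close> is the average of a
\<open>2d\<close>-th power and of an element \<open>1 + y\<close> of the same kind, and iterating this writes \<open>1 + x\<close> as a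
limit of sums of \<open>2d\<close>-th powers (\<open>one_plus_small_in_closed_cone\<close>). Modules over an archimedean
preprime obey a Positivstellensatz: a proper module is contained in a maximal one, a maximal
proper module orders the hermitian elements totally, its infinitesimals form an ideal of
codimension one, and the quotient map is a character that is nonnegative on the module
(\<open>proper_module_character\<close>). Hence every hermitian element that is strictly positive at all
characters nonnegative on \<open>M\<close> lies in \<open>M\<close> (\<open>archimedean_positivstellensatz\<close>). These characters are
automatically \<open>\<phi>\<close>-continuous because they are nonnegative on \<open>1 + x\<close> for small \<open>x\<close>. Adding small
positive constants and using that \<open>M\<close> is closed gives the description of the closure
(\<open>herm_closure_eq_Pos\<close>).

For the measure-theoretic half, the set \<open>K\<close> of continuous characters that are nonnegative on \<open>S\<close> is
compact by Tychonoff's theorem. By the first half, \<open>L\<close> is nonnegative on every hermitian element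
whose Gelfand transform is nonnegative on \<open>K\<close>. By the Stone-Weierstrass theorem these transforms
are dense in the continuous functions on \<open>K\<close>, so \<open>L\<close> induces a positive functional there, and the
Riesz representation theorem yields a measure. Since \<open>K\<close> need not be metrizable, the Riesz theorem
is derived from Caratheodory's construction. For uniqueness, comparing the moments of \<open>(a * star a)\<^sup>n\<close>
with \<open>\<phi>\<close> shows that any representing Radon measure vanishes off the compact spectrum of \<open>\<phi>\<close>
(\<open>null_off_spectrum\<close>), and two such measures with equal integrals of all Gelfand transforms agree on
compact sets (\<open>representing_measure_unique\<close>). The support statement then follows, since the measure
that was constructed vanishes off \<open>K\<close>.\<close>

section \<open>Riesz representation on compact Hausdorff spaces\<close>

lemma continuous_map_borel_measurable:
  assumes "space M = topspace X" "sets M = sigma_sets (topspace X) {U. openin X U}"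
    and f: "continuous_map X euclidean f"
  shows "f \<in> borel_measurable M"
proof (rule borel_measurableI)
  fix S :: "'b set" assume "open S"
  then have "openin X {x \<in> topspace X. f x \<in> S}"
    by (intro openin_continuous_map_preimage[OF f]) (simp add: openin_open)
  moreover have "f -` S \<inter> space M = {x \<in> topspace X. f x \<in> S}" using assms(1) by auto
  ultimately show "f -` S \<inter> space M \<in> sets M" using assms(2) by auto
qed

text \<open>The layers of height one into which the interval from \<open>0\<close> to \<open>t\<close> is cut: applied to \<open>n * f x\<close>, it splits
a function into layers with values between \<open>0\<close> and \<open>1\<close>, each supported on a superlevel set.\<close>

lemma sum_unit_slices:
  fixes t :: real
  assumes "0 \<le> t"
  shows "(\<Sum>i<n. min 1 (max 0 (t - real i))) = min (real n) t"
proof (induction n)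
  case (Suc n)
  have "min (real n) t + min 1 (max 0 (t - real n)) = min (real (Suc n)) t"
    by (simp add: min_def max_def)
  then show ?case using Suc by simp
qed (use assms in simp)

text \<open>Positivity looks at points of the space only, so \<open>\<Lambda>\<close> does not depend on the values that a function
takes outside \<open>topspace X\<close>.\<close>

locale positive_functional =
  fixes X :: "'x topology" and \<Lambda> :: "('x \<Rightarrow> real) \<Rightarrow> real"
  assumes compact: "compact_space X" and Hausdorff: "Hausdorff_space X"
    and additive: "continuous_map X euclideanreal f \<Longrightarrow> continuous_map X euclideanreal g \<Longrightarrow>
      \<Lambda> (\<lambda>x. f x + g x) = \<Lambda> f + \<Lambda> g"
    and homogeneous: "continuous_map X euclideanreal f \<Longrightarrow> \<Lambda> (\<lambda>x. c * f x) = c * \<Lambda> f"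
    and nonneg: "continuous_map X euclideanreal f \<Longrightarrow> (\<And>x. x \<in> topspace X \<Longrightarrow> 0 \<le> f x) \<Longrightarrow> 0 \<le> \<Lambda> f"
begin

abbreviation cont :: "('x \<Rightarrow> real) \<Rightarrow> bool" where "cont \<equiv> continuous_map X euclideanreal"

abbreviation mass :: real where "mass \<equiv> \<Lambda> (\<lambda>_. 1)"

lemma mono:
  assumes "cont f" "cont g" "\<And>x. x \<in> topspace X \<Longrightarrow> f x \<le> g x"
  shows "\<Lambda> f \<le> \<Lambda> g"
proof -
  have d: "cont (\<lambda>x. g x - f x)" using assms by (intro continuous_intros)
  have "\<Lambda> g = \<Lambda> f + \<Lambda> (\<lambda>x. g x - f x)" using additive[OF assms(1) d] by simp
  moreover have "0 \<le> \<Lambda> (\<lambda>x. g x - f x)" using assms(3) by (intro nonneg d) simp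
  ultimately show ?thesis by simp
qed

lemma mass_nonneg: "0 \<le> mass"
  by (intro nonneg) auto

lemma sum_functional:
  assumes "\<And>i. i < n \<Longrightarrow> cont (f i)"
  shows "cont (\<lambda>x. \<Sum>i<n. f i x) \<and> \<Lambda> (\<lambda>x. \<Sum>i<(n::nat). f i x) = (\<Sum>i<n. \<Lambda> (f i))"
  using assms
proof (induction n)
  case 0
  show ?case using homogeneous[of "\<lambda>_. 0" 0] by simp
next
  case (Suc n)
  then have IH: "cont (\<lambda>x. \<Sum>i<n. f i x)" "\<Lambda> (\<lambda>x. \<Sum>i<n. f i x) = (\<Sum>i<n. \<Lambda> (f i))" and fn: "cont (f n)" by auto
  then show ?case using additive[OF IH(1) fn] by (auto intro!: continuous_intros)
qed

text \<open>Functions subordinate to an open set \<open>U\<close> are only required to vanish off \<open>U\<close>, instead of having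
compact support inside \<open>U\<close>. By the lemma \<open>truncate\<close> below, the suprema of \<open>\<Lambda>\<close> over the two classes
coincide.\<close>

definition subordinate :: "'x set \<Rightarrow> ('x \<Rightarrow> real) set"
  where "subordinate U = {f. cont f \<and> (\<forall>x\<in>topspace X. 0 \<le> f x \<and> f x \<le> 1) \<and> (\<forall>x\<in>topspace X - U. f x = 0)}"

definition open_content :: "'x set \<Rightarrow> ennreal"
  where "open_content U = (SUP f\<in>subordinate U. ennreal (\<Lambda> f))"

lemma subordinateD:
  assumes "f \<in> subordinate U"
  shows "cont f" "x \<in> topspace X \<Longrightarrow> 0 \<le> f x" "x \<in> topspace X \<Longrightarrow> f x \<le> 1"
    "x \<in> topspace X \<Longrightarrow> x \<notin> U \<Longrightarrow> f x = 0" "0 \<le> \<Lambda> f"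
  using assms nonneg[of f] by (auto simp: subordinate_def)

lemma open_content_upper: "f \<in> subordinate U \<Longrightarrow> ennreal (\<Lambda> f) \<le> open_content U"
  unfolding open_content_def by (rule SUP_upper)

lemma open_content_mono: "U \<inter> topspace X \<subseteq> V \<Longrightarrow> open_content U \<le> open_content V"
  unfolding open_content_def by (rule SUP_subset_mono) (auto simp: subordinate_def)

lemma open_content_le_mass: "open_content U \<le> ennreal mass"
  unfolding open_content_def using subordinateD(1,3) by (intro SUP_least ennreal_leI mono) auto

lemma open_content_topspace: "open_content (topspace X) = ennreal mass"
proof (rule antisym[OF open_content_le_mass])
  have "(\<lambda>_. 1) \<in> subordinate (topspace X)" by (simp add: subordinate_def)
  then show "ennreal mass \<le> open_content (topspace X)" by (rule open_content_upper)
qed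

lemma zero_subordinate: "(\<lambda>_. 0) \<in> subordinate U"
  by (auto simp: subordinate_def)

lemma open_content_empty: "open_content {} = 0"
proof -
  have "ennreal (\<Lambda> f) = 0" if "f \<in> subordinate {}" for f
  proof -
    have "\<Lambda> f \<le> \<Lambda> (\<lambda>_. 0)" using subordinateD[OF that] by (intro mono) auto
    then show ?thesis using homogeneous[of "\<lambda>_. 0" 0] by (simp add: ennreal_neg)
  qed
  then have "open_content {} \<le> 0" unfolding open_content_def by (intro SUP_least) simp
  then show ?thesis by simp
qed

lemma open_content_approx:
  assumes "e > 0"
  obtains f where "f \<in> subordinate U" "open_content U \<le> ennreal (\<Lambda> f) + ennreal e"
proof -
  have "open_content U \<noteq> \<infinity>" using open_content_le_mass[of U] by (auto simp: top_unique)
  then have "\<exists>f\<in>subordinate U. open_content U < ennreal (\<Lambda> f) + ennreal e"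
    using zero_subordinate[of U] by (intro SUP_approx_ennreal[OF assms _ open_content_def]) auto
  then show thesis using that less_imp_le by blast
qed

lemma open_content_leI:
  assumes "\<And>f e. f \<in> subordinate U \<Longrightarrow> e > 0 \<Longrightarrow> ennreal (\<Lambda> f) \<le> c + ennreal e"
  shows "open_content U \<le> c"
  unfolding open_content_def by (rule SUP_least, rule ennreal_le_epsilon, rule assms)

text \<open>Lowering \<open>f\<close> by a small constant and cutting it off at \<open>0\<close> costs little, and the result is supported on
the closed set where \<open>f\<close> is at least that constant, which lies inside \<open>U\<close>.\<close>

lemma truncate:
  assumes f: "f \<in> subordinate U" and e: "e > 0"
  obtains g C where "g \<in> subordinate U" "\<Lambda> f \<le> \<Lambda> g + e" "closedin X C" "C \<subseteq> U" "\<And>x. x \<in> topspace X \<Longrightarrow> x \<notin> C \<Longrightarrow> g x = 0"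
proof -
  define d where "d = e / (mass + 1)"
  have d: "d > 0" "d * mass \<le> e" using e mass_nonneg by (auto simp: d_def field_simps)
  define g where "g x = max 0 (f x - d)" for x
  define C where "C = {x \<in> topspace X. f x \<in> {d..}}"
  have g: "cont g" unfolding g_def using subordinateD(1)[OF f] by (intro continuous_intros)
  have "\<Lambda> f \<le> \<Lambda> (\<lambda>x. g x + d * 1)"
  proof (rule mono[OF subordinateD(1)[OF f]])
    show "cont (\<lambda>x. g x + d * 1)" using g by (intro continuous_intros)
    show "f x \<le> g x + d * 1" for x by (simp add: g_def)
  qed
  also have "\<dots> = \<Lambda> g + d * mass"
    using additive[OF g, of "\<lambda>x. d * 1"] homogeneous[of "\<lambda>_. 1" d] by simp
  finally have "\<Lambda> f \<le> \<Lambda> g + e" using d(2) by simp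
  moreover have "g \<in> subordinate U" using g subordinateD[OF f] d(1) by (fastforce simp: subordinate_def g_def)
  moreover have "closedin X C"
    unfolding C_def by (rule closedin_continuous_map_preimage[OF subordinateD(1)[OF f]]) simp
  moreover have "C \<subseteq> U" using subordinateD(4)[OF f] d(1) by (force simp: C_def)
  moreover have "g x = 0" if "x \<in> topspace X" "x \<notin> C" for x using that by (auto simp: g_def C_def)
  ultimately show thesis using that by blast
qed

lemma subordinate_mono: "f \<in> subordinate U \<Longrightarrow> (\<And>x. x \<in> topspace X \<Longrightarrow> x \<notin> V \<Longrightarrow> f x = 0) \<Longrightarrow> f \<in> subordinate V"
  by (auto simp: subordinate_def)

text \<open>After truncation, the part of the support outside \<open>V\<close> is a closed subset of \<open>U\<close>. A Urysohn function
that is \<open>1\<close> there and \<open>0\<close> off \<open>U\<close> splits the truncated function into a part subordinate to \<open>U\<close> and a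
part subordinate to \<open>V\<close>.\<close>

lemma open_content_Un:
  assumes "openin X U" "openin X V"
  shows "open_content (U \<union> V) \<le> open_content U + open_content V"
proof (rule open_content_leI)
  fix f and e :: real assume f: "f \<in> subordinate (U \<union> V)" and "e > 0"
  obtain g C where g: "g \<in> subordinate (U \<union> V)" "\<Lambda> f \<le> \<Lambda> g + e" "closedin X C" "C \<subseteq> U \<union> V"
    "\<And>x. x \<in> topspace X \<Longrightarrow> x \<notin> C \<Longrightarrow> g x = 0" using truncate[OF f \<open>e > 0\<close>] by blast
  have "normal_space X" using compact Hausdorff compact_Hausdorff_or_regular_imp_normal_space by blast
  moreover have "closedin X (C - V)" "closedin X (topspace X - U)"
    using assms g(3) by (auto intro: closedin_diff)
  moreover have "disjnt (C - V) (topspace X - U)" using g(4) by (auto simp: disjnt_def)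
  ultimately obtain u where u: "continuous_map X (top_of_set {0..1::real}) u"
    "u ` (C - V) \<subseteq> {1}" "u ` (topspace X - U) \<subseteq> {0}"
    using Urysohn_lemma[of X "topspace X - U" "C - V" 0 1] by (metis disjnt_sym zero_le_one)
  have uc: "cont u" and u01: "\<And>x. x \<in> topspace X \<Longrightarrow> 0 \<le> u x \<and> u x \<le> 1"
    using u(1) by (auto simp: continuous_map_in_subtopology)
  note gD = subordinateD[OF g(1)]
  have 1: "(\<lambda>x. g x * u x) \<in> subordinate U"
    using gD u01 u(3) uc by (auto simp: subordinate_def mult_le_one intro!: continuous_intros)
  have 2: "(\<lambda>x. g x * (1 - u x)) \<in> subordinate V"
    unfolding subordinate_def
  proof (intro CollectI conjI ballI)
    show "cont (\<lambda>x. g x * (1 - u x))" using gD(1) uc by (intro continuous_intros)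
    fix x assume x: "x \<in> topspace X"
    show "0 \<le> g x * (1 - u x)" "g x * (1 - u x) \<le> 1" using gD(2,3)[OF x] u01[OF x] by (auto intro!: mult_le_one)
  next
    fix x assume "x \<in> topspace X - V"
    then show "g x * (1 - u x) = 0" using g(5)[of x] u(2) by (cases "x \<in> C") auto
  qed
  have "\<Lambda> g = \<Lambda> (\<lambda>x. g x * u x) + \<Lambda> (\<lambda>x. g x * (1 - u x))"
    using additive[OF subordinateD(1)[OF 1] subordinateD(1)[OF 2]] by (simp add: algebra_simps)
  then have "ennreal (\<Lambda> f) \<le> ennreal (\<Lambda> (\<lambda>x. g x * u x) + \<Lambda> (\<lambda>x. g x * (1 - u x)) + e)"
    using g(2) by (intro ennreal_leI) simp
  also have "\<dots> = ennreal (\<Lambda> (\<lambda>x. g x * u x)) + ennreal (\<Lambda> (\<lambda>x. g x * (1 - u x))) + ennreal e"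
    using subordinateD(5)[OF 1] subordinateD(5)[OF 2] \<open>e > 0\<close> by (simp add: ennreal_plus)
  also have "\<dots> \<le> open_content U + open_content V + ennreal e"
    by (intro add_mono open_content_upper 1 2 order_refl)
  finally show "ennreal (\<Lambda> f) \<le> open_content U + open_content V + ennreal e" .
qed

text \<open>The support of a truncated function is compact, so finitely many of the sets cover it.\<close>

lemma open_content_countable_union:
  fixes U :: "nat \<Rightarrow> 'x set"
  assumes "\<And>i. openin X (U i)"
  shows "open_content (\<Union>i. U i) \<le> (\<Sum>i. open_content (U i))"
proof (rule open_content_leI)
  have fin: "open_content (\<Union>i<n. U i) \<le> (\<Sum>i<n. open_content (U i))" for n
  proof (induction n)
    case (Suc n)
    have "open_content (\<Union>i<Suc n. U i) = open_content ((\<Union>i<n. U i) \<union> U n)"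
      by (simp add: lessThan_Suc Un_commute)
    also have "\<dots> \<le> open_content (\<Union>i<n. U i) + open_content (U n)" using assms by (intro open_content_Un) auto
    also have "\<dots> \<le> (\<Sum>i<Suc n. open_content (U i))" using Suc by (simp add: add_right_mono)
    finally show ?case .
  qed (simp add: open_content_empty)
  fix f and e :: real assume e: "e > 0" and f: "f \<in> subordinate (\<Union>i. U i)"
  obtain g C where g: "g \<in> subordinate (\<Union>i. U i)" "\<Lambda> f \<le> \<Lambda> g + e" "closedin X C" "C \<subseteq> (\<Union>i. U i)"
    "\<And>x. x \<in> topspace X \<Longrightarrow> x \<notin> C \<Longrightarrow> g x = 0" using truncate[OF f e] by blast
  have "compactin X C" using g(3) compact closedin_compact_space by blast
  then obtain \<F> where \<F>: "finite \<F>" "\<F> \<subseteq> range U" "C \<subseteq> \<Union>\<F>"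
    using compactinD[of X C "range U"] g(4) assms by auto
  then obtain I where I: "finite I" "\<F> = U ` I" by (metis finite_subset_image)
  then obtain n where "I \<subseteq> {..<n}" using finite_nat_iff_bounded by blast
  then have "C \<subseteq> (\<Union>i<n. U i)" using \<F>(3) I(2) by blast
  then have gn: "g \<in> subordinate (\<Union>i<n. U i)" using g(5) by (intro subordinate_mono[OF g(1)]) auto
  have "ennreal (\<Lambda> f) \<le> ennreal (\<Lambda> g + e)" using g(2) by (intro ennreal_leI)
  also have "\<dots> = ennreal (\<Lambda> g) + ennreal e" using e subordinateD(5)[OF g(1)] by (simp add: ennreal_plus)
  also have "\<dots> \<le> open_content (\<Union>i<n. U i) + ennreal e" by (intro add_right_mono open_content_upper gn)
  also have "\<dots> \<le> (\<Sum>i. open_content (U i)) + ennreal e"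
    by (intro add_right_mono order_trans[OF fin] sum_le_suminf) auto
  finally show "ennreal (\<Lambda> f) \<le> (\<Sum>i. open_content (U i)) + ennreal e" .
qed

definition outer :: "'x set \<Rightarrow> ennreal"
  where "outer E = (INF U\<in>{U. openin X U \<and> E \<subseteq> U}. open_content U)"

lemma outer_le: "openin X U \<Longrightarrow> E \<subseteq> U \<Longrightarrow> outer E \<le> open_content U"
  unfolding outer_def by (rule INF_lower) simp

lemma outer_open: "openin X U \<Longrightarrow> outer U = open_content U"
  by (intro antisym outer_le order_refl) (auto simp: outer_def intro!: INF_greatest open_content_mono)

lemma outer_mono: "E \<subseteq> F \<Longrightarrow> outer E \<le> outer F"
  unfolding outer_def by (rule INF_superset_mono) auto

lemma outer_approx:
  assumes "E \<subseteq> topspace X" "e > 0"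
  obtains U where "openin X U" "E \<subseteq> U" "open_content U \<le> outer E + ennreal e"
proof -
  have "outer E \<le> ennreal mass"
    using outer_le[of "topspace X" E] assms(1) open_content_topspace by simp
  then have "outer E \<noteq> \<infinity>" by (auto simp: top_unique)
  then show thesis
    using INF_approx_ennreal[OF assms(2) outer_def] that less_imp_le by blast
qed

lemma outer_measure: "outer_measure_space (Pow (topspace X)) outer"
  unfolding outer_measure_space_def
proof (intro conjI)
  show "positive (Pow (topspace X)) outer"
    using outer_open[of "{}"] open_content_empty by (simp add: positive_def)
  show "increasing (Pow (topspace X)) outer"
    by (simp add: increasing_def outer_mono)
  show "countably_subadditive (Pow (topspace X)) outer"
    unfolding countably_subadditive_def
  proof (intro allI impI)
    fix A :: "nat \<Rightarrow> 'x set" assume A: "range A \<subseteq> Pow (topspace X)"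
    show "outer (\<Union>i. A i) \<le> (\<Sum>i. outer (A i))"
    proof (rule ennreal_le_epsilon)
      fix e :: real assume e: "e > 0"
      have "\<exists>U. openin X U \<and> A i \<subseteq> U \<and> open_content U \<le> outer (A i) + ennreal (e * (1/2) ^ Suc i)" for i
      proof -
        have "A i \<subseteq> topspace X" "e * (1/2) ^ Suc i > 0" using A e by auto
        then show ?thesis using outer_approx[of "A i" "e * (1/2) ^ Suc i"] by blast
      qed
      then obtain U where U: "\<And>i. openin X (U i)" "\<And>i. A i \<subseteq> U i"
        "\<And>i. open_content (U i) \<le> outer (A i) + ennreal (e * (1/2) ^ Suc i)" by metis
      have "(\<lambda>i. e * (1/2) ^ Suc i) sums (e * 1)" by (intro sums_mult power_half_series)
      then have half: "(\<Sum>i. ennreal (e * (1/2) ^ Suc i)) = ennreal e"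
        using e by (intro suminf_ennreal_eq) auto
      have "outer (\<Union>i. A i) \<le> open_content (\<Union>i. U i)" using U(1,2) by (intro outer_le) auto
      also have "\<dots> \<le> (\<Sum>i. open_content (U i))" by (rule open_content_countable_union[OF U(1)])
      also have "\<dots> \<le> (\<Sum>i. outer (A i) + ennreal (e * (1/2) ^ Suc i))"
        by (intro suminf_le U(3)) auto
      also have "\<dots> = (\<Sum>i. outer (A i)) + ennreal e"
        by (subst suminf_add[symmetric]) (auto simp only: half summableI)
      finally show "outer (\<Union>i. A i) \<le> (\<Sum>i. outer (A i)) + ennreal e" .
    qed
  qed
qed

lemma outer_Un:
  assumes "E \<subseteq> topspace X" "F \<subseteq> topspace X" "E \<inter> F = {}"
  shows "outer (E \<union> F) \<le> outer E + outer F"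
proof -
  interpret ring_of_sets "topspace X" "Pow (topspace X)" by (rule ring_of_sets_Pow)
  have "subadditive (Pow (topspace X)) outer"
    by (rule countably_subadditive_subadditive)
      (use outer_measure in \<open>simp_all add: outer_measure_space_def\<close>)
  then show ?thesis using assms by (auto simp: subadditive_def)
qed

text \<open>If \<open>g\<close> nearly attains the content of \<open>V \<inter> U\<close> and is supported on a closed \<open>C \<subseteq> V \<inter> U\<close>, and \<open>h\<close> nearly
attains the content of the open set \<open>V - C\<close>, then \<open>g + h\<close> is still bounded by \<open>1\<close>, hence subordinate
to \<open>V\<close>. This superadditivity is what makes open sets measurable in the sense of Caratheodory.\<close>

lemma open_split:
  assumes "openin X U" "openin X V"
  shows "open_content (V \<inter> U) + outer (V - U) \<le> open_content V"
proof (rule ennreal_le_epsilon)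
  fix e :: real assume "e > 0"
  then have e: "e / 3 > 0" by simp
  obtain f where f: "f \<in> subordinate (V \<inter> U)" "open_content (V \<inter> U) \<le> ennreal (\<Lambda> f) + ennreal (e / 3)"
    using open_content_approx[OF e, of "V \<inter> U"] by blast
  obtain g C where g: "g \<in> subordinate (V \<inter> U)" "\<Lambda> f \<le> \<Lambda> g + e / 3" "closedin X C" "C \<subseteq> V \<inter> U"
    "\<And>x. x \<in> topspace X \<Longrightarrow> x \<notin> C \<Longrightarrow> g x = 0" using truncate[OF f(1) e] by blast
  have VC: "openin X (V - C)" using assms(2) g(3) by (rule openin_diff)
  obtain h where h: "h \<in> subordinate (V - C)" "open_content (V - C) \<le> ennreal (\<Lambda> h) + ennreal (e / 3)"
    using open_content_approx[OF e, of "V - C"] by blast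
  note gD = subordinateD[OF g(1)] and hD = subordinateD[OF h(1)]
  have gh: "(\<lambda>x. g x + h x) \<in> subordinate V"
    unfolding subordinate_def
  proof (intro CollectI conjI ballI)
    show "cont (\<lambda>x. g x + h x)" using gD(1) hD(1) by (intro continuous_intros)
    fix x assume x: "x \<in> topspace X"
    show "0 \<le> g x + h x" using gD(2)[OF x] hD(2)[OF x] by simp
    show "g x + h x \<le> 1" using gD(3)[OF x] hD(3)[OF x] hD(4)[OF x] g(5)[OF x] by (cases "x \<in> C") auto
  next
    fix x assume "x \<in> topspace X - V"
    then show "g x + h x = 0" using gD(4)[of x] hD(4)[of x] by auto
  qed
  have "outer (V - U) \<le> open_content (V - C)" using g(4) by (intro outer_le VC) auto
  then have "open_content (V \<inter> U) + outer (V - U)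
      \<le> (ennreal (\<Lambda> f) + ennreal (e / 3)) + (ennreal (\<Lambda> h) + ennreal (e / 3))"
    using f(2) h(2) by (intro add_mono) auto
  also have "\<dots> = ennreal (\<Lambda> f + e / 3 + (\<Lambda> h + e / 3))"
    using subordinateD(5)[OF f(1)] hD(5) \<open>e > 0\<close>
    by (simp add: ennreal_plus[symmetric] del: ennreal_plus)
  also have "\<dots> \<le> ennreal (\<Lambda> (\<lambda>x. g x + h x) + e)"
    using g(2) additive[OF gD(1) hD(1)] by (intro ennreal_leI) simp
  also have "\<dots> = ennreal (\<Lambda> (\<lambda>x. g x + h x)) + ennreal e"
    using subordinateD(5)[OF gh] \<open>e > 0\<close> by (simp add: ennreal_plus[symmetric] del: ennreal_plus)
  also have "\<dots> \<le> open_content V + ennreal e" by (intro add_right_mono open_content_upper gh)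
  finally show "open_content (V \<inter> U) + outer (V - U) \<le> open_content V + ennreal e" .
qed

lemma open_in_lambda_system:
  assumes U: "openin X U"
  shows "U \<in> lambda_system (topspace X) (Pow (topspace X)) outer"
proof -
  have sub: "U \<subseteq> topspace X" using U by (rule openin_subset)
  have "outer (U \<inter> E) + outer ((topspace X - U) \<inter> E) = outer E" if E: "E \<subseteq> topspace X" for E
  proof (rule antisym)
    have "outer ((U \<inter> E) \<union> ((topspace X - U) \<inter> E)) \<le> outer (U \<inter> E) + outer ((topspace X - U) \<inter> E)"
      using E by (intro outer_Un) auto
    moreover have "(U \<inter> E) \<union> ((topspace X - U) \<inter> E) = E" using E by auto
    ultimately show "outer E \<le> outer (U \<inter> E) + outer ((topspace X - U) \<inter> E)" by simp
    show "outer (U \<inter> E) + outer ((topspace X - U) \<inter> E) \<le> outer E"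
    proof (rule ennreal_le_epsilon)
      fix e :: real assume "e > 0"
      then obtain V where V: "openin X V" "E \<subseteq> V" "open_content V \<le> outer E + ennreal e"
        using outer_approx[OF E] by blast
      have "outer (U \<inter> E) + outer ((topspace X - U) \<inter> E) \<le> open_content (V \<inter> U) + outer (V - U)"
        using U V by (intro add_mono outer_le outer_mono) auto
      also have "\<dots> \<le> open_content V" by (rule open_split[OF U V(1)])
      also note V(3)
      finally show "outer (U \<inter> E) + outer ((topspace X - U) \<inter> E) \<le> outer E + ennreal e" .
    qed
  qed
  then show ?thesis using sub by (auto simp: lambda_system_def)
qed

definition riesz_measure :: "'x measure"
  where "riesz_measure = measure_of (topspace X) {U. openin X U} outer"

lemma open_Pow: "{U. openin X U} \<subseteq> Pow (topspace X)"
  using openin_subset by blast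

lemma space_riesz: "space riesz_measure = topspace X"
  and sets_riesz: "sets riesz_measure = sigma_sets (topspace X) {U. openin X U}"
  unfolding riesz_measure_def using open_Pow by (simp_all add: space_measure_of sets_measure_of)

lemma emeasure_riesz:
  assumes "A \<in> sets riesz_measure"
  shows "emeasure riesz_measure A = outer A"
proof -
  let ?L = "lambda_system (topspace X) (Pow (topspace X)) outer"
  interpret sigma_algebra "topspace X" "Pow (topspace X)" by (rule sigma_algebra_Pow)
  have L: "measure_space (topspace X) ?L outer" by (rule caratheodory_lemma[OF outer_measure])
  then interpret L: sigma_algebra "topspace X" ?L by (simp add: measure_space_def)
  have "sigma_sets (topspace X) {U. openin X U} \<subseteq> ?L"
    by (intro L.sigma_sets_subset) (auto intro: open_in_lambda_system)
  then have "measure_space (topspace X) (sigma_sets (topspace X) {U. openin X U}) outer"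
    by (intro measure_down[OF L] sigma_algebra_sigma_sets open_Pow)
  then show ?thesis
    using assms by (intro emeasure_measure_of[OF riesz_measure_def open_Pow])
      (auto simp: measure_space_def sets_riesz)
qed

lemma finite_riesz: "finite_measure riesz_measure"
  and measure_riesz_space: "measure riesz_measure (topspace X) = mass"
proof -
  have "emeasure riesz_measure (topspace X) = ennreal mass"
    using emeasure_riesz[of "topspace X"] outer_open[of "topspace X"] open_content_topspace sets.top[of riesz_measure]
    by (simp add: space_riesz)
  then show "finite_measure riesz_measure" "measure riesz_measure (topspace X) = mass"
    using mass_nonneg by (auto intro!: finite_measureI simp: space_riesz measure_def)
qed

text \<open>Outer regularity holds by construction of the outer measure. Applied to the complement of a set
it gives inner regularity, because closed subsets of a compact space are compact.\<close>

lemma radon_riesz: "radon_measure X riesz_measure"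
  unfolding radon_measure_def
proof (intro conjI ballI)
  interpret finite_measure riesz_measure by (rule finite_riesz)
  show "Hausdorff_space X" by (rule Hausdorff)
  show "space riesz_measure = topspace X" "sets riesz_measure = sigma_sets (topspace X) {U. openin X U}"
    by (rule space_riesz sets_riesz)+
  have top: "emeasure riesz_measure (topspace X) < \<infinity>"
    by (simp add: emeasure_eq_measure)
  show "\<exists>U. openin X U \<and> x \<in> U \<and> emeasure riesz_measure U < \<infinity>" if "x \<in> topspace X" for x
    using that top by (intro exI[of _ "topspace X"]) auto
  fix B assume B: "B \<in> sets riesz_measure"
  then have BX: "B \<subseteq> topspace X" using sets.sets_into_space space_riesz by blast
  show "emeasure riesz_measure B = (SUP K\<in>{K. compactin X K \<and> K \<subseteq> B}. emeasure riesz_measure K)"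
  proof (rule ennreal_approx_SUP)
    show "emeasure riesz_measure K \<le> emeasure riesz_measure B" if "K \<in> {K. compactin X K \<and> K \<subseteq> B}" for K
      using that B by (intro emeasure_mono) auto
    fix e :: real assume e: "e > 0"
    have Bc: "topspace X - B \<in> sets riesz_measure" using B by (metis sets.compl_sets space_riesz)
    obtain U where U: "openin X U" "topspace X - B \<subseteq> U" "open_content U \<le> outer (topspace X - B) + ennreal e"
      using outer_approx[of "topspace X - B" e] e by blast
    define K where "K = topspace X - U"
    have Us: "U \<in> sets riesz_measure" using U(1) by (auto simp: sets_riesz)
    have Ks: "K \<in> sets riesz_measure" unfolding K_def using Us by (metis sets.compl_sets space_riesz)
    have "closedin X K" using U(1) by (auto simp: K_def)
    then have K: "compactin X K" "K \<subseteq> B" using compact closedin_compact_space U(2) by (auto simp: K_def)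
    have "measure riesz_measure U \<le> measure riesz_measure (topspace X - B) + e"
    proof -
      have "emeasure riesz_measure U \<le> emeasure riesz_measure (topspace X - B) + ennreal e"
        using U(3) by (simp add: emeasure_riesz[OF Us] emeasure_riesz[OF Bc] outer_open[OF U(1)])
      then show ?thesis using e by (simp add: emeasure_eq_measure ennreal_plus[symmetric] del: ennreal_plus)
    qed
    then have "measure riesz_measure B \<le> measure riesz_measure K + e"
      using finite_measure_compl[OF Us] finite_measure_compl[OF B] unfolding K_def space_riesz by simp
    then have "emeasure riesz_measure B \<le> emeasure riesz_measure K + ennreal e"
      using e by (simp add: emeasure_eq_measure ennreal_plus[symmetric] del: ennreal_plus)
    then show "\<exists>K\<in>{K. compactin X K \<and> K \<subseteq> B}. emeasure riesz_measure B \<le> emeasure riesz_measure K + ennreal e"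
      using K by blast
  qed
qed

lemma integrable_riesz:
  assumes f: "cont f"
  shows "integrable riesz_measure f"
proof -
  interpret finite_measure riesz_measure by (rule finite_riesz)
  have "compactin euclideanreal (f ` topspace X)"
    using image_compactin[OF _ f] compact by (simp add: compact_space_def)
  then have "bounded (f ` topspace X)" by (simp add: compact_imp_bounded)
  then obtain B where "\<And>x. x \<in> topspace X \<Longrightarrow> norm (f x) \<le> B" by (auto simp: bounded_iff)
  then show ?thesis
    by (intro integrable_const_bound[of _ B] AE_I2 continuous_map_borel_measurable[OF space_riesz sets_riesz f])
      (simp add: space_riesz)
qed

text \<open>A layer-cake estimate: the \<open>i\<close>-th layer of \<open>n * f\<close> is subordinate to the open set where \<open>n * f > i\<close>,
so \<open>\<Lambda>\<close> of the layer is at most the measure of that set, which is at most the integral of the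
\<open>i\<close>-th layer of \<open>n * f + 1\<close>. The summed error is the total mass, and it is negligible after division
by \<open>n\<close>.\<close>

lemma functional_le_integral:
  assumes f: "cont f" "\<And>x. x \<in> topspace X \<Longrightarrow> 0 \<le> f x \<and> f x \<le> 1"
  shows "\<Lambda> f \<le> (\<integral>x. f x \<partial>riesz_measure)"
proof -
  interpret finite_measure riesz_measure by (rule finite_riesz)
  have slices: "n * \<Lambda> f \<le> n * (\<integral>x. f x \<partial>riesz_measure) + mass" for n :: nat
  proof -
    \<comment> \<open>the \<open>i\<close>-th layers of \<open>n * f\<close> and of \<open>n * f + 1\<close>; the indicator of \<open>U i\<close> lies between them\<close>
    define g where "g i x = min 1 (max 0 (n * f x - real i))" for i :: nat and x
    define h where "h i x = min 1 (max 0 ((n * f x + 1) - real i))" for i :: nat and x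
    define U where "U i = {x \<in> topspace X. n * f x \<in> {real i<..}}" for i :: nat
    have g: "cont (g i)" and h: "cont (h i)" for i
      unfolding g_def h_def using f(1) by (auto intro!: continuous_intros)
    have U: "openin X (U i)" for i
      unfolding U_def using f(1)
      by (intro openin_continuous_map_preimage[of _ euclideanreal]) (auto intro!: continuous_intros simp: openin_open)
    have Us: "U i \<in> sets riesz_measure" for i using U by (auto simp: sets_riesz)
    have step: "\<Lambda> (g i) \<le> (\<integral>x. h i x \<partial>riesz_measure)" for i
    proof -
      have "g i \<in> subordinate (U i)" unfolding subordinate_def using g[of i] by (auto simp: g_def U_def)
      from open_content_upper[OF this] have "ennreal (\<Lambda> (g i)) \<le> ennreal (measure riesz_measure (U i))"
        by (simp add: emeasure_riesz[OF Us] outer_open[OF U] flip: emeasure_eq_measure)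
      then have "\<Lambda> (g i) \<le> measure riesz_measure (U i)" by simp
      also have "\<dots> = (\<integral>x. indicator (U i) x \<partial>riesz_measure)" using Us by simp
      also have "\<dots> \<le> (\<integral>x. h i x \<partial>riesz_measure)"
      proof (rule integral_mono)
        show "integrable riesz_measure (indicator (U i) :: 'x \<Rightarrow> real)"
          using Us by (simp add: emeasure_eq_measure)
        show "integrable riesz_measure (h i)" by (rule integrable_riesz[OF h])
        show "indicator (U i) x \<le> h i x" for x by (auto simp: h_def U_def indicator_def)
      qed
      finally show ?thesis .
    qed
    have "n * \<Lambda> f = \<Lambda> (\<lambda>x. n * f x)" using homogeneous[OF f(1)] by simp
    also have "\<dots> \<le> \<Lambda> (\<lambda>x. \<Sum>i<n. g i x)"
      using f(2) sum_functional[of n g] g f(1) unfolding g_def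
      by (intro mono) (auto intro!: continuous_intros simp: sum_unit_slices mult_left_le)
    also have "\<dots> = (\<Sum>i<n. \<Lambda> (g i))" using sum_functional[of n g] g by blast
    also have "\<dots> \<le> (\<Sum>i<n. \<integral>x. h i x \<partial>riesz_measure)" by (intro sum_mono step)
    also have "\<dots> = (\<integral>x. (\<Sum>i<n. h i x) \<partial>riesz_measure)"
      using h by (simp add: integrable_riesz)
    also have "\<dots> \<le> (\<integral>x. n * f x + 1 \<partial>riesz_measure)"
      using f(2) h f(1) by (intro integral_mono Bochner_Integration.integrable_sum integrable_riesz)
        (auto intro!: continuous_intros simp: h_def sum_unit_slices space_riesz)
    also have "\<dots> = n * (\<integral>x. f x \<partial>riesz_measure) + mass"
      using integrable_riesz[OF f(1)] measure_riesz_space by (simp add: space_riesz)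
    finally show ?thesis .
  qed
  show ?thesis
  proof (rule ccontr)
    assume "\<not> ?thesis"
    then have pos: "0 < \<Lambda> f - (\<integral>x. f x \<partial>riesz_measure)" by simp
    then obtain n :: nat where "mass < n * (\<Lambda> f - (\<integral>x. f x \<partial>riesz_measure))"
      using reals_Archimedean3 by blast
    then show False using slices[of n] by (simp add: algebra_simps)
  qed
qed

text \<open>For functions with values between \<open>0\<close> and \<open>1\<close> the reverse inequality is the estimate for \<open>1 - g\<close>.
Every continuous function on a compact space is an affine image of such a function.\<close>

theorem integral_riesz:
  assumes f: "cont f"
  shows "(\<integral>x. f x \<partial>riesz_measure) = \<Lambda> f"
proof -
  interpret finite_measure riesz_measure by (rule finite_riesz)
  have unit: "(\<integral>x. g x \<partial>riesz_measure) = \<Lambda> g"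
    if g: "cont g" "\<And>x. x \<in> topspace X \<Longrightarrow> 0 \<le> g x \<and> g x \<le> 1" for g
  proof (rule antisym)
    have c: "cont (\<lambda>x. 1 - g x)" using g(1) by (intro continuous_intros)
    have "\<Lambda> (\<lambda>x. 1 - g x) \<le> (\<integral>x. 1 - g x \<partial>riesz_measure)"
      using g(2) by (intro functional_le_integral c) auto
    moreover have "mass = \<Lambda> (\<lambda>x. 1 - g x) + \<Lambda> g" using additive[OF c g(1)] by simp
    moreover have "(\<integral>x. 1 - g x \<partial>riesz_measure) = mass - (\<integral>x. g x \<partial>riesz_measure)"
      using integrable_riesz[OF g(1)] measure_riesz_space by (simp add: space_riesz)
    ultimately show "(\<integral>x. g x \<partial>riesz_measure) \<le> \<Lambda> g" by simp
  qed (rule functional_le_integral[OF g])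
  have "compactin euclideanreal (f ` topspace X)"
    using image_compactin[OF _ f] compact by (simp add: compact_space_def)
  then have "bounded (f ` topspace X)" by (simp add: compact_imp_bounded)
  then obtain B where B: "B > 0" "\<And>x. x \<in> topspace X \<Longrightarrow> \<bar>f x\<bar> \<le> B" by (auto simp: bounded_pos)
  have c: "cont (\<lambda>x. f x + B * 1)" using f by (intro continuous_intros)
  have "\<Lambda> (\<lambda>x. (1 / (2 * B)) * (f x + B * 1)) = (\<integral>x. (1 / (2 * B)) * (f x + B * 1) \<partial>riesz_measure)"
  proof (rule unit[symmetric])
    show "cont (\<lambda>x. (1 / (2 * B)) * (f x + B * 1))" using f by (intro continuous_intros)
    fix x assume "x \<in> topspace X"
    then show "0 \<le> (1 / (2 * B)) * (f x + B * 1) \<and> (1 / (2 * B)) * (f x + B * 1) \<le> 1"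
      using B(1) B(2)[of x] by (auto simp: abs_le_iff field_simps)
  qed
  moreover have "\<Lambda> (\<lambda>x. (1 / (2 * B)) * (f x + B * 1)) = (1 / (2 * B)) * (\<Lambda> f + B * mass)"
    unfolding homogeneous[OF c] using additive[OF f, of "\<lambda>_. B * 1"] homogeneous[of "\<lambda>_. 1" B] by simp
  moreover have "(\<integral>x. (1 / (2 * B)) * (f x + B * 1) \<partial>riesz_measure)
      = (1 / (2 * B)) * ((\<integral>x. f x \<partial>riesz_measure) + B * mass)"
    using integrable_riesz[OF f] measure_riesz_space by (simp add: space_riesz)
  ultimately show ?thesis using B(1) by simp
qed

end

section \<open>Null sets, supports and images of Radon measures\<close>

lemma Hausdorff_space_euclidean_t2: "Hausdorff_space (euclidean :: 'a::t2_space topology)"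
proof -
  have "\<exists>U V. open U \<and> open V \<and> x \<in> U \<and> y \<in> V \<and> disjnt U V" if "x \<noteq> y" for x y :: 'a
    using hausdorff[OF that] by (auto simp: disjnt_def)
  then show ?thesis by (simp add: Hausdorff_space_def)
qed

text \<open>The family may be uncountable: by inner regularity only compact subsets of the union matter, and
each of them is covered by finitely many members.\<close>

lemma radon_null_Union:
  assumes M: "radon_measure X M" and \<U>: "\<And>U. U \<in> \<U> \<Longrightarrow> openin X U" "\<And>U. U \<in> \<U> \<Longrightarrow> emeasure M U = 0"
  shows "emeasure M (\<Union>\<U>) = 0"
proof -
  note Mdefs = M[unfolded radon_measure_def]
  have open_sets: "U \<in> sets M" if "openin X U" for U using Mdefs that by auto
  have "emeasure M K = 0" if K: "compactin X K" "K \<subseteq> \<Union>\<U>" for K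
  proof -
    obtain \<F> where \<F>: "finite \<F>" "\<F> \<subseteq> \<U>" "K \<subseteq> \<Union>\<F>" using compactinD[OF K(1) \<U>(1) K(2)] by blast
    have "emeasure M K \<le> emeasure M (\<Union>\<F>)"
      using \<F> \<U>(1) by (intro emeasure_mono open_sets openin_Union) auto
    also have "\<dots> = emeasure M (\<Union>U\<in>\<F>. U)" by simp
    also have "\<dots> \<le> (\<Sum>U\<in>\<F>. emeasure M U)"
      using \<F> \<U>(1) open_sets by (intro emeasure_subadditive_finite) auto
    also have "\<dots> = 0" using \<F>(2) \<U>(2) by (intro sum.neutral) auto
    finally show ?thesis by simp
  qed
  moreover have "\<Union>\<U> \<in> sets M" using \<U>(1) by (intro open_sets openin_Union)
  then have "emeasure M (\<Union>\<U>) = (SUP K\<in>{K. compactin X K \<and> K \<subseteq> \<Union>\<U>}. emeasure M K)"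
    using Mdefs by blast
  moreover have "(SUP K\<in>{K. compactin X K \<and> K \<subseteq> \<Union>\<U>}. emeasure M K) \<le> 0"
    using calculation(1) by (intro SUP_least) auto
  ultimately show ?thesis by simp
qed

lemma support_subset:
  assumes "openin X (topspace X - K)" "emeasure M (topspace X - K) = 0"
  shows "measure_support X M \<subseteq> K"
proof
  fix x assume x: "x \<in> measure_support X M"
  show "x \<in> K"
  proof (rule ccontr)
    assume "x \<notin> K"
    then have "emeasure M (topspace X - K) > 0" using x assms(1) unfolding measure_support_def by blast
    then show False using assms(2) by simp
  qed
qed

lemma radon_push_forward:
  assumes X: "Hausdorff_space X" and K: "closedin X K"
    and M: "radon_measure (subtopology X K) M" "finite_measure M"
  defines "N \<equiv> distr M (sigma (topspace X) {U. openin X U}) (\<lambda>x. x)"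
  shows "radon_measure X N" "emeasure N (topspace X - K) = 0" "(\<lambda>x. x) \<in> measurable M (sigma (topspace X) {U. openin X U})"
proof -
  note Mdefs = M(1)[unfolded radon_measure_def]
  have KX: "K \<subseteq> topspace X" using K by (rule closedin_subset)
  then have spM: "space M = K" using Mdefs by (auto simp: topspace_subtopology)
  have Pow: "{U. openin X U} \<subseteq> Pow (topspace X)" using openin_subset by blast
  have spN: "space N = topspace X" and setsN: "sets N = sigma_sets (topspace X) {U. openin X U}"
    using Pow by (simp_all add: N_def space_measure_of sets_measure_of)
  show meas: "(\<lambda>x. x) \<in> measurable M (sigma (topspace X) {U. openin X U})"
  proof (rule measurable_measure_of[OF Pow])
    show "(\<lambda>x. x) \<in> space M \<rightarrow> topspace X" using spM KX by auto
    fix U assume "U \<in> {U. openin X U}"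
    then have "openin (subtopology X K) (U \<inter> K)" by (auto simp: openin_subtopology)
    then have "U \<inter> K \<in> sets M" using Mdefs by auto
    then show "(\<lambda>x. x) -` U \<inter> space M \<in> sets M" by (simp add: spM)
  qed
  have em: "emeasure N B = emeasure M (B \<inter> K)" "B \<inter> K \<in> sets M" if "B \<in> sets N" for B
    using that emeasure_distr[OF meas, of B] measurable_sets[OF meas, of B] Pow
    by (auto simp: N_def spM setsN[unfolded N_def] sets_measure_of)
  have XN: "topspace X \<in> sets N" using sets.top[of N] spN by simp
  have "topspace X - K \<in> sets N" using K by (auto simp: setsN closedin_def)
  moreover have "(topspace X - K) \<inter> K = {}" by auto
  ultimately show "emeasure N (topspace X - K) = 0" using em(1) by (metis emeasure_empty)
  show "radon_measure X N"
    unfolding radon_measure_def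
  proof (intro conjI ballI X spN setsN)
    fix x assume "x \<in> topspace X"
    moreover have "emeasure N (topspace X) < \<infinity>"
      unfolding em(1)[OF XN] by (simp add: finite_measure.emeasure_eq_measure[OF M(2)])
    ultimately show "\<exists>U. openin X U \<and> x \<in> U \<and> emeasure N U < \<infinity>"
      by (intro exI[of _ "topspace X"]) auto
  next
    fix B assume B: "B \<in> sets N"
    have "emeasure N B = (SUP C\<in>{C. compactin (subtopology X K) C \<and> C \<subseteq> B \<inter> K}. emeasure M C)"
      using Mdefs em[OF B] by metis
    also have "\<dots> \<le> (SUP C\<in>{C. compactin X C \<and> C \<subseteq> B}. emeasure N C)"
    proof (rule SUP_mono)
      fix C assume "C \<in> {C. compactin (subtopology X K) C \<and> C \<subseteq> B \<inter> K}"
      then have C: "compactin X C" "C \<subseteq> K" "C \<subseteq> B" by (auto simp: compactin_subtopology)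
      have "closedin X C" using C(1) X by (rule compactin_imp_closedin[rotated])
      then have "topspace X - C \<in> sets N" by (auto simp: setsN closedin_def)
      from sets.Diff[OF XN this] have "topspace X - (topspace X - C) \<in> sets N" .
      moreover have "topspace X - (topspace X - C) = C" using closedin_subset[OF \<open>closedin X C\<close>] by auto
      ultimately have "emeasure N C = emeasure M C" using em(1)[of C] C(2) by (simp add: Int_absorb2)
      then show "\<exists>D\<in>{C. compactin X C \<and> C \<subseteq> B}. emeasure M C \<le> emeasure N D" using C by auto
    qed
    finally have "emeasure N B \<le> (SUP C\<in>{C. compactin X C \<and> C \<subseteq> B}. emeasure N C)" .
    moreover have "emeasure N C \<le> emeasure N B" if "C \<in> {C. compactin X C \<and> C \<subseteq> B}" for C
      using that B by (intro emeasure_mono) auto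
    ultimately show "emeasure N B = (SUP C\<in>{C. compactin X C \<and> C \<subseteq> B}. emeasure N C)"
      by (intro antisym SUP_least)
  qed
qed

section \<open>Hermitian elements and characters\<close>

context star_algebra
begin

definition rscale :: "real \<Rightarrow> 'a \<Rightarrow> 'a" (infixr "\<cdot>" 75)
  where "r \<cdot> a = scaleC (complex_of_real r) a"

abbreviation H :: "'a set" where "H \<equiv> hermitian star"

lemma rscale_simps [simp]:
  "r \<cdot> (a + b) = r \<cdot> a + r \<cdot> b" "r \<cdot> (a - b) = r \<cdot> a - r \<cdot> b" "r \<cdot> (- a) = - (r \<cdot> a)" "r \<cdot> 0 = 0"
  "r \<cdot> s \<cdot> a = (r * s) \<cdot> a" "1 \<cdot> a = a" "0 \<cdot> a = 0"
  "(r \<cdot> a) * b = r \<cdot> (a * b)" "a * (r \<cdot> b) = r \<cdot> (a * b)"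
proof -
  show "a * (r \<cdot> b) = r \<cdot> (a * b)"
    using scaleC_mult_left[of "complex_of_real r" b a] by (simp add: rscale_def mult.commute)
qed (simp_all add: rscale_def scale_right_distrib scale_right_diff_distrib scaleC_mult_left)

lemma rscale_add_left: "(r + s) \<cdot> a = r \<cdot> a + s \<cdot> a"
  and rscale_diff_left: "(r - s) \<cdot> a = r \<cdot> a - s \<cdot> a"
  and rscale_minus_left: "(- r) \<cdot> a = - (r \<cdot> a)"
  by (simp_all add: rscale_def scale_left_distrib scale_left_diff_distrib)

lemma star_zero [simp]: "star 0 = 0"
  using star_scaleC[of 0 0] by simp

lemma star_minus [simp]: "star (- a) = - star a"
  using star_scaleC[of "-1" a] by simp

lemma star_diff [simp]: "star (a - b) = star a - star b"
  using star_add[of a "- b"] by simp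

lemma star_one [simp]: "star 1 = 1"
  by (metis mult.right_neutral mult.commute star_mult star_star)

lemma star_rscale [simp]: "star (r \<cdot> a) = r \<cdot> star a"
  by (simp add: rscale_def star_scaleC)

lemma star_power: "star (a ^ n) = star a ^ n"
  by (induction n) (auto simp: star_mult)

lemma hermitian_iff: "a \<in> H \<longleftrightarrow> star a = a"
  by (simp add: hermitian_def)

lemma hermitian_closed [simp, intro]:
  "0 \<in> H" "1 \<in> H"
  "a \<in> H \<Longrightarrow> b \<in> H \<Longrightarrow> a + b \<in> H" "a \<in> H \<Longrightarrow> b \<in> H \<Longrightarrow> a - b \<in> H"
  "a \<in> H \<Longrightarrow> - a \<in> H" "a \<in> H \<Longrightarrow> b \<in> H \<Longrightarrow> a * b \<in> H"
  "a \<in> H \<Longrightarrow> r \<cdot> a \<in> H" "a \<in> H \<Longrightarrow> a ^ n \<in> H"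
  by (simp_all add: hermitian_iff star_add star_mult star_power)

lemma cartesian_decomposition:
  obtains h k where "h \<in> H" "k \<in> H" "a = h + scaleC \<i> k"
proof
  show "(1/2) \<cdot> (a + star a) \<in> H" "scaleC (- \<i> / 2) (a - star a) \<in> H"
    by (simp_all add: hermitian_iff star_add star_star add.commute star_scaleC scale_right_diff_distrib)
  have "(1/2) \<cdot> a + (1/2) \<cdot> a = a"
    using rscale_add_left[of "1/2" "1/2" a] by simp
  then show "a = (1/2) \<cdot> (a + star a) + scaleC \<i> (scaleC (- \<i> / 2) (a - star a))"
    by (simp add: scale_right_diff_distrib rscale_def algebra_simps)
qed

lemma star_linearD:
  assumes "star_linear scaleC star L"
  shows "L (a + b) = L a + L b" "L (a - b) = L a - L b" "L 0 = 0" "L (- a) = - L a"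
    "L (scaleC c a) = c * L a" "L (r \<cdot> a) = complex_of_real r * L a"
    "L (star a) = cnj (L a)" "a \<in> H \<Longrightarrow> L a = complex_of_real (Re (L a))"
proof -
  interpret L: Vector_Spaces.linear scaleC "(*)" L using assms by (simp add: star_linear_def)
  show "L (a + b) = L a + L b" "L (a - b) = L a - L b" "L 0 = 0" "L (- a) = - L a"
    "L (scaleC c a) = c * L a" "L (r \<cdot> a) = complex_of_real r * L a"
    by (simp_all add: L.add L.diff L.neg L.scale rscale_def)
  show star: "L (star a) = cnj (L a)" for a using assms by (simp add: star_linear_def)
  show "L a = complex_of_real (Re (L a))" if "a \<in> H"
    using star[of a] that by (simp add: hermitian_iff complex_eq_iff)
qed

lemma star_linearI:
  assumes "\<And>a b. L (a + b) = L a + L b" "\<And>c a. L (scaleC c a) = c * L a" "\<And>a. L (star a) = cnj (L a)"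
  shows "star_linear scaleC star L"
  unfolding star_linear_def using assms
  by (auto intro!: Vector_Spaces.linear.intro vector_space_axioms
      simp: module_hom_axioms_def module_hom_def vector_space_def module_def algebra_simps)

lemma characterD:
  assumes "\<alpha> \<in> characters scaleC star"
  shows "star_linear scaleC star \<alpha>" "\<alpha> (a * b) = \<alpha> a * \<alpha> b" "\<alpha> 1 = 1" "\<alpha> (a ^ n) = \<alpha> a ^ n"
proof -
  show "star_linear scaleC star \<alpha>" and *: "\<And>a b. \<alpha> (a * b) = \<alpha> a * \<alpha> b" "\<alpha> 1 = 1"
    using assms by (auto simp: characters_def)
  show "\<alpha> (a ^ n) = \<alpha> a ^ n" by (induction n) (auto simp: *)
qed

text \<open>The residue of \<open>a\<close> modulo \<open>I\<close> is a scalar, which is unique because \<open>I\<close> is proper. Taking residues is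
a homomorphism because \<open>I\<close> is an ideal that is stable under the involution.\<close>

lemma ideal_of_codimension_one_character:
  assumes add: "\<And>x y. x \<in> I \<Longrightarrow> y \<in> I \<Longrightarrow> x + y \<in> I"
    and mult: "\<And>a x. x \<in> I \<Longrightarrow> a * x \<in> I"
    and star: "\<And>x. x \<in> I \<Longrightarrow> star x \<in> I"
    and proper: "1 \<notin> I"
    and codim: "\<And>a. \<exists>c. a - scaleC c 1 \<in> I"
  obtains \<alpha> where "\<alpha> \<in> characters scaleC star" "\<And>x. x \<in> I \<Longrightarrow> \<alpha> x = 0"
proof -
  have sc: "scaleC c x \<in> I" if "x \<in> I" for c x
    using mult[OF that, of "scaleC c 1"] by (simp add: scaleC_mult_left)
  have diff: "x - y \<in> I" if "x \<in> I" "y \<in> I" for x y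
    using add[OF that(1) sc[OF that(2), of "-1"]] by simp
  obtain \<alpha> where \<alpha>: "\<And>a. a - scaleC (\<alpha> a) 1 \<in> I"
    using codim by metis
  have eqI: "\<alpha> a = c" if "a - scaleC c 1 \<in> I" for a c
  proof (rule ccontr)
    assume ne: "\<alpha> a \<noteq> c"
    have "scaleC (\<alpha> a - c) 1 \<in> I"
      using diff[OF that \<alpha>[of a]] by (simp add: scale_left_diff_distrib)
    from sc[OF this, of "inverse (\<alpha> a - c)"] ne proper show False by simp
  qed
  have "\<alpha> (a + b) = \<alpha> a + \<alpha> b" for a b
    using add[OF \<alpha>[of a] \<alpha>[of b]] by (intro eqI) (simp add: scale_left_distrib algebra_simps)
  moreover have "\<alpha> (scaleC c a) = c * \<alpha> a" for a c
    using sc[OF \<alpha>[of a], of c] by (intro eqI) (simp add: scale_right_diff_distrib)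
  moreover have "\<alpha> (star a) = cnj (\<alpha> a)" for a
    using star[OF \<alpha>[of a]] by (intro eqI) (simp add: star_scaleC)
  moreover have "\<alpha> 1 = 1"
    using sc[OF \<alpha>[of 1], of 0] by (intro eqI) simp
  moreover have "\<alpha> (a * b) = \<alpha> a * \<alpha> b" for a b
  proof (rule eqI)
    have "a * (b - scaleC (\<alpha> b) 1) + scaleC (\<alpha> b) (a - scaleC (\<alpha> a) 1) \<in> I"
      by (intro add mult sc \<alpha>)
    moreover have "a * scaleC c 1 = scaleC c a" for c
      using scaleC_mult_left[of c 1 a] by (simp add: mult.commute)
    ultimately show "a * b - scaleC (\<alpha> a * \<alpha> b) 1 \<in> I"
      by (simp add: algebra_simps scale_right_diff_distrib)
  qed
  ultimately have "\<alpha> \<in> characters scaleC star"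
    unfolding characters_def using star_linearI[of \<alpha>] by blast
  moreover have "\<alpha> x = 0" if "x \<in> I" for x
    using that by (intro eqI) simp
  ultimately show thesis using that by blast
qed

section \<open>Archimedean modules and characters\<close>

definition archimedean_preprime :: "'a set \<Rightarrow> bool"
  where "archimedean_preprime T \<longleftrightarrow>
    T \<subseteq> H \<and> (\<forall>s\<in>T. \<forall>t\<in>T. s + t \<in> T \<and> s * t \<in> T) \<and> (\<forall>r\<ge>0. r \<cdot> 1 \<in> T) \<and>
    (\<forall>x\<in>H. \<exists>r. r \<cdot> 1 + x \<in> T)"

definition preprime_module :: "'a set \<Rightarrow> 'a set \<Rightarrow> bool"
  where "preprime_module T M \<longleftrightarrow>
    M \<subseteq> H \<and> 1 \<in> M \<and> (\<forall>x\<in>M. \<forall>y\<in>M. x + y \<in> M) \<and> (\<forall>t\<in>T. \<forall>x\<in>M. t * x \<in> M)"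

lemma preprime_moduleD:
  assumes "archimedean_preprime T" "preprime_module T M"
  shows "x \<in> M \<Longrightarrow> x \<in> H" "t \<in> T \<Longrightarrow> t \<in> H" "x \<in> M \<Longrightarrow> y \<in> M \<Longrightarrow> x + y \<in> M"
    "t \<in> T \<Longrightarrow> x \<in> M \<Longrightarrow> t * x \<in> M" "t \<in> T \<Longrightarrow> t \<in> M" "0 \<le> r \<Longrightarrow> r \<cdot> 1 \<in> M" "0 \<le> r \<Longrightarrow> r \<cdot> 1 \<in> T"
    "x \<in> M \<Longrightarrow> 0 \<le> r \<Longrightarrow> r \<cdot> x \<in> M" "0 \<in> M" "0 \<in> T" "1 \<in> M" "1 \<in> T"
    "s \<in> T \<Longrightarrow> t \<in> T \<Longrightarrow> s + t \<in> T" "s \<in> T \<Longrightarrow> t \<in> T \<Longrightarrow> s * t \<in> T"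
proof -
  note defs = assms[unfolded archimedean_preprime_def preprime_module_def]
  show mult: "t * x \<in> M" if "t \<in> T" "x \<in> M" for t x using defs that by blast
  show TM: "t \<in> M" if "t \<in> T" for t using mult[OF that, of 1] defs by simp
  show real: "r \<cdot> 1 \<in> T" if "0 \<le> r" for r using defs that by blast
  show "r \<cdot> 1 \<in> M" if "0 \<le> r" for r using real TM that by blast
  show "r \<cdot> x \<in> M" if "x \<in> M" "0 \<le> r" for r x using mult[OF real that(1), of r] that by simp
  show "0 \<in> T" "1 \<in> T" using real[of 0] real[of 1] by auto
  then show "0 \<in> M" using TM by blast
qed (use assms in \<open>auto simp: archimedean_preprime_def preprime_module_def\<close>)

lemma archimedean_preprime_bound:
  assumes "archimedean_preprime T" "x \<in> H"
  obtains k where "k > 0" "k \<cdot> 1 + x \<in> T" "k \<cdot> 1 - x \<in> T"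
proof -
  have "- x \<in> H" using assms(2) by auto
  then obtain r s where rs: "r \<cdot> 1 + x \<in> T" "s \<cdot> 1 + - x \<in> T"
    using assms unfolding archimedean_preprime_def by meson
  have up: "k \<cdot> 1 + y \<in> T" if "r \<cdot> 1 + y \<in> T" "r \<le> k" for k r y
  proof -
    have "(k - r) \<cdot> 1 + (r \<cdot> 1 + y) \<in> T"
      using assms(1) that unfolding archimedean_preprime_def by simp
    then show ?thesis by (simp add: rscale_diff_left algebra_simps)
  qed
  show thesis
    using up[OF rs(1), of "max 1 (max r s)"] up[OF rs(2), of "max 1 (max r s)"]
    by (intro that[of "max 1 (max r s)"]) auto
qed

text \<open>If neither \<open>x\<close> nor \<open>- x\<close> belonged to \<open>Q\<close>, then by maximality both \<open>Q + T * x\<close> and \<open>Q - T * x\<close> would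
contain \<open>- 1\<close>. Combining these two relations forces \<open>- 1 \<in> Q\<close>.\<close>

lemma maximal_proper_module_total:
  assumes T: "archimedean_preprime T" and Q: "preprime_module T Q" "- 1 \<notin> Q"
    and max: "\<And>Q'. preprime_module T Q' \<Longrightarrow> - 1 \<notin> Q' \<Longrightarrow> Q \<subseteq> Q' \<Longrightarrow> Q' = Q"
    and x: "x \<in> H"
  shows "x \<in> Q \<or> - x \<in> Q"
proof (rule ccontr)
  assume not: "\<not> (x \<in> Q \<or> - x \<in> Q)"
  note TQ = preprime_moduleD[OF T Q(1)]
  have meets: "\<exists>q\<in>Q. \<exists>t\<in>T. - 1 = q + t * y" if y: "y \<in> H" "y \<notin> Q" for y
  proof (rule ccontr)
    assume no: "\<not> ?thesis"
    define Q' where "Q' = {q + t * y |q t. q \<in> Q \<and> t \<in> T}"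
    have Q'I: "q + t * y \<in> Q'" if "q \<in> Q" "t \<in> T" for q t using that Q'_def by blast
    have "Q \<subseteq> Q'" using Q'I[OF _ TQ(10)] by auto
    moreover have "y \<in> Q'" using Q'I[OF TQ(9) TQ(12)] by simp
    moreover have "- 1 \<notin> Q'" using no unfolding Q'_def by blast
    moreover have "preprime_module T Q'"
      unfolding preprime_module_def
    proof (intro conjI ballI)
      show "Q' \<subseteq> H" using TQ(1,2) y unfolding Q'_def by auto
      show "1 \<in> Q'" using Q'I[OF TQ(11,10)] by simp
      fix a assume "a \<in> Q'"
      then obtain q t where a: "a = q + t * y" "q \<in> Q" "t \<in> T" unfolding Q'_def by blast
      show "a + b \<in> Q'" if b': "b \<in> Q'" for b
      proof -
        obtain q' t' where b: "b = q' + t' * y" "q' \<in> Q" "t' \<in> T" using b' unfolding Q'_def by blast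
        show ?thesis using Q'I[OF TQ(3)[OF a(2) b(2)] TQ(13)[OF a(3) b(3)]]
          by (simp add: a(1) b(1) algebra_simps)
      qed
      show "s * a \<in> Q'" if "s \<in> T" for s
        using Q'I[OF TQ(4)[OF that a(2)] TQ(14)[OF that a(3)]] by (simp add: a(1) algebra_simps)
    qed
    ultimately show False using max y(2) by blast
  qed
  obtain q1 t1 where 1: "q1 \<in> Q" "t1 \<in> T" "- 1 = q1 + t1 * x" using meets x not by blast
  obtain q2 t2 where 2: "q2 \<in> Q" "t2 \<in> T" "- 1 = q2 + t2 * - x" using meets[of "- x"] x not by auto
  \<comment> \<open>eliminating \<open>x\<close> puts \<open>- t1\<close> into \<open>Q\<close>; multiplied by \<open>k - x\<close>, this gives \<open>t1 * x \<in> Q\<close>\<close>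
  have "t2 * q1 + t1 * q2 = t2 * (q1 + t1 * x) + t1 * (q2 + t2 * - x)"
    by (simp add: algebra_simps)
  also have "\<dots> = - t2 - t1" unfolding 1(3)[symmetric] 2(3)[symmetric] by simp
  finally have "(t2 * q1 + t1 * q2) + t2 = - t1" by simp
  moreover have "(t2 * q1 + t1 * q2) + t2 \<in> Q"
    using 1 2 TQ(3,4,5) by simp
  ultimately have neg: "- t1 \<in> Q" by simp
  obtain k where k: "k > 0" "k \<cdot> 1 - x \<in> T" using archimedean_preprime_bound[OF T x] by blast
  have "(k \<cdot> 1 - x) * (- t1) \<in> Q" by (rule TQ(4)[OF k(2) neg])
  moreover have "k \<cdot> t1 \<in> Q" using TQ(8)[OF TQ(5)[OF 1(2)]] k(1) by simp
  ultimately have "(k \<cdot> 1 - x) * (- t1) + k \<cdot> t1 \<in> Q" by (rule TQ(3))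
  then have "t1 * x \<in> Q" by (simp add: algebra_simps)
  then have "q1 + t1 * x \<in> Q" using 1(1) TQ(3) by blast
  then show False using 1(3) Q(2) by simp
qed

text \<open>By Zorn's lemma it suffices to treat a maximal proper module \<open>Q\<close>. Since \<open>Q\<close> orders the hermitian
elements totally and \<open>T\<close> is archimedean, each hermitian element differs from a unique real number
by an infinitesimal. The infinitesimals form an ideal, because every hermitian element is a
difference of two elements of \<open>T\<close>.\<close>

theorem proper_module_character:
  assumes T: "archimedean_preprime T" and M: "preprime_module T M" "- 1 \<notin> M"
  obtains \<alpha> where "\<alpha> \<in> characters scaleC star" "\<And>x. x \<in> M \<Longrightarrow> 0 \<le> Re (\<alpha> x)"
proof -
  define F where "F = {Q. preprime_module T Q \<and> - 1 \<notin> Q \<and> M \<subseteq> Q}"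
  have "\<Union>\<C> \<in> F" if "\<C> \<noteq> {}" "subset.chain F \<C>" for \<C>
  proof -
    have C: "\<And>Q. Q \<in> \<C> \<Longrightarrow> preprime_module T Q \<and> - 1 \<notin> Q \<and> M \<subseteq> Q"
      and chain: "\<And>P Q. P \<in> \<C> \<Longrightarrow> Q \<in> \<C> \<Longrightarrow> P \<subseteq> Q \<or> Q \<subseteq> P"
      using that(2) unfolding subset.chain_def F_def by blast+
    have "x + y \<in> \<Union>\<C>" if xy: "x \<in> \<Union>\<C>" "y \<in> \<Union>\<C>" for x y
    proof -
      obtain Q where "Q \<in> \<C>" "x \<in> Q" "y \<in> Q" using xy chain by blast
      then show ?thesis using C unfolding preprime_module_def by blast
    qed
    moreover have "t * x \<in> \<Union>\<C>" if "t \<in> T" "x \<in> \<Union>\<C>" for t x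
      using that C unfolding preprime_module_def by blast
    moreover have "\<Union>\<C> \<subseteq> H" "1 \<in> \<Union>\<C>" "M \<subseteq> \<Union>\<C>" "- 1 \<notin> \<Union>\<C>"
      using that(1) C unfolding preprime_module_def by blast+
    ultimately show ?thesis unfolding preprime_module_def F_def by blast
  qed
  moreover have "F \<noteq> {}" using M F_def by blast
  ultimately have "\<exists>Q\<in>F. \<forall>X\<in>F. Q \<subseteq> X \<longrightarrow> X = Q"
    by (intro subset_Zorn_nonempty)
  then obtain Q where QF: "Q \<in> F" and maxF: "\<And>X. X \<in> F \<Longrightarrow> Q \<subseteq> X \<Longrightarrow> X = Q" by blast
  from QF have Q: "preprime_module T Q" "- 1 \<notin> Q" "M \<subseteq> Q" by (auto simp: F_def)
  have max: "preprime_module T Q' \<Longrightarrow> - 1 \<notin> Q' \<Longrightarrow> Q \<subseteq> Q' \<Longrightarrow> Q' = Q" for Q'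
    using Q(3) by (intro maxF) (auto simp: F_def)
  note TQ = preprime_moduleD[OF T Q(1)]
  note total = maximal_proper_module_total[OF T Q(1,2) max]
  have real_nonneg: "0 \<le> r" if "r \<cdot> 1 \<in> Q" for r
  proof (rule ccontr)
    assume "\<not> 0 \<le> r"
    then have "(- 1 / r) \<cdot> r \<cdot> 1 \<in> Q" by (intro TQ(8)[OF that]) (simp add: divide_simps)
    then show False using Q(2) \<open>\<not> 0 \<le> r\<close> by (simp add: rscale_minus_left)
  qed
  \<comment> \<open>the elements that are infinitesimal for the order defined by \<open>Q\<close>\<close>
  define J where "J = {x \<in> H. \<forall>e>0. e \<cdot> 1 + x \<in> Q \<and> e \<cdot> 1 - x \<in> Q}"
  have J_H: "x \<in> H" if "x \<in> J" for x using that J_def by blast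
  have J_minus: "- x \<in> J" if "x \<in> J" for x using that unfolding J_def by auto
  have J_add: "x + y \<in> J" if "x \<in> J" "y \<in> J" for x y
    unfolding J_def
  proof (intro CollectI conjI allI impI)
    fix e :: real assume "e > 0"
    then have half: "(e/2) \<cdot> 1 + x \<in> Q" "(e/2) \<cdot> 1 + y \<in> Q" "(e/2) \<cdot> 1 - x \<in> Q" "(e/2) \<cdot> 1 - y \<in> Q"
      using that unfolding J_def by auto
    have e: "e \<cdot> 1 = (e/2) \<cdot> 1 + (e/2) \<cdot> 1" using rscale_add_left[of "e/2" "e/2" 1] by simp
    show "e \<cdot> 1 + (x + y) \<in> Q" using TQ(3)[OF half(1,2)] by (simp add: e algebra_simps)
    show "e \<cdot> 1 - (x + y) \<in> Q" using TQ(3)[OF half(3,4)] by (simp add: e algebra_simps)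
  qed (use that in \<open>auto simp: J_def\<close>)
  have J_mult_T: "t * x \<in> J" if t: "t \<in> T" and x: "x \<in> J" for t x
    unfolding J_def
  proof (intro CollectI conjI allI impI)
    show "t * x \<in> H" using t x TQ(2) J_H by auto
    fix e :: real assume e: "e > 0"
    obtain k where k: "k > 0" "k \<cdot> 1 - t \<in> T" using archimedean_preprime_bound[OF T TQ(2)[OF t]] by blast
    have ek: "0 \<le> e / k" using e k(1) by simp
    have rest: "(e/k) \<cdot> (k \<cdot> 1 - t) \<in> Q" by (rule TQ(8)[OF TQ(5)[OF k(2)] ek])
    have "t * ((e/k) \<cdot> 1 + x) \<in> Q" "t * ((e/k) \<cdot> 1 - x) \<in> Q"
      using x e k(1) by (auto intro!: TQ(4)[OF t] simp: J_def)
    from TQ(3)[OF this(1) rest] TQ(3)[OF this(2) rest]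
    show "e \<cdot> 1 + t * x \<in> Q" "e \<cdot> 1 - t * x \<in> Q"
      using k(1) by (simp_all add: algebra_simps)
  qed
  have J_mult: "a * x \<in> J" if a: "a \<in> H" and x: "x \<in> J" for a x
  proof -
    obtain k where k: "k > 0" "k \<cdot> 1 + a \<in> T" using archimedean_preprime_bound[OF T a] by blast
    have "(k \<cdot> 1 + a) * x + - ((k \<cdot> 1) * x) \<in> J"
      using k by (intro J_add J_minus J_mult_T x TQ(7)) auto
    then show ?thesis by (simp add: algebra_simps)
  qed
  have J_codim: "\<exists>r. x - r \<cdot> 1 \<in> J" if x: "x \<in> H" for x
  proof -
    let ?A = "{r. x - r \<cdot> 1 \<in> Q}"
    obtain k where k: "k > 0" "k \<cdot> 1 + x \<in> T" "k \<cdot> 1 - x \<in> T"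
      using archimedean_preprime_bound[OF T x] by blast
    have "- k \<in> ?A" using TQ(5)[OF k(2)] by (simp add: rscale_minus_left add.commute)
    moreover have "r \<le> k" if "r \<in> ?A" for r
    proof -
      have "(k \<cdot> 1 - x) + (x - r \<cdot> 1) \<in> Q" using that by (intro TQ(3)[OF TQ(5)[OF k(3)]]) auto
      then have "(k - r) \<cdot> 1 \<in> Q" by (simp add: rscale_diff_left)
      then show ?thesis using real_nonneg by fastforce
    qed
    ultimately have ne: "?A \<noteq> {}" and bdd: "bdd_above ?A" by (blast, force)
    define c where "c = Sup ?A"
    have "x - c \<cdot> 1 \<in> J"
      unfolding J_def
    proof (intro CollectI conjI allI impI)
      show "x - c \<cdot> 1 \<in> H" using x by auto
      fix e :: real assume e: "e > 0"
      obtain r where r: "x - r \<cdot> 1 \<in> Q" "c - e < r"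
        using less_cSupD[OF ne, of "c - e"] e unfolding c_def by auto
      have "(x - r \<cdot> 1) + (r - (c - e)) \<cdot> 1 \<in> Q" using r(2) by (intro TQ(3) TQ(6) r) auto
      then show "e \<cdot> 1 + (x - c \<cdot> 1) \<in> Q" by (simp add: rscale_diff_left rscale_add_left algebra_simps)
      have "c + e \<notin> ?A" using cSup_upper[OF _ bdd, of "c + e"] e unfolding c_def by auto
      then have "- (x - (c + e) \<cdot> 1) \<in> Q" using total[of "x - (c + e) \<cdot> 1"] x by auto
      then show "e \<cdot> 1 - (x - c \<cdot> 1) \<in> Q" by (simp add: rscale_add_left algebra_simps)
    qed
    then show ?thesis by blast
  qed
  define I where "I = {h + scaleC \<i> k |h k. h \<in> J \<and> k \<in> J}"
  have II: "h + scaleC \<i> k \<in> I" if "h \<in> J" "k \<in> J" for h k using that I_def by blast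
  obtain \<alpha> where \<alpha>: "\<alpha> \<in> characters scaleC star" "\<And>x. x \<in> I \<Longrightarrow> \<alpha> x = 0"
  proof (rule ideal_of_codimension_one_character[of I])
    fix x assume "x \<in> I"
    then obtain h k where x: "x = h + scaleC \<i> k" "h \<in> J" "k \<in> J" unfolding I_def by blast
    show "x + y \<in> I" if "y \<in> I" for y
    proof -
      obtain h' k' where y: "y = h' + scaleC \<i> k'" "h' \<in> J" "k' \<in> J" using \<open>y \<in> I\<close> unfolding I_def by blast
      show ?thesis using II[OF J_add[OF x(2) y(2)] J_add[OF x(3) y(3)]] x y
        by (simp add: scale_right_distrib algebra_simps)
    qed
    show "star x \<in> I"
      using II[OF x(2) J_minus[OF x(3)]] J_H[OF x(2)] J_H[OF x(3)] x(1)
      by (simp add: star_add star_scaleC hermitian_iff)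
    show "a * x \<in> I" for a
    proof -
      obtain h' k' where a: "h' \<in> H" "k' \<in> H" "a = h' + scaleC \<i> k'" by (rule cartesian_decomposition)
      have "(h' * h + - (k' * k)) + scaleC \<i> (h' * k + k' * h) \<in> I"
        by (intro II J_add J_minus J_mult a x)
      moreover have "b * scaleC c d = scaleC c (b * d)" for b c d
        using scaleC_mult_left[of c d b] by (simp add: mult.commute)
      ultimately show ?thesis
        by (simp add: a(3) x(1) scaleC_mult_left scale_right_distrib algebra_simps)
    qed
  next
    show "1 \<notin> I"
    proof
      assume "1 \<in> I"
      then obtain h k where hk: "1 = h + scaleC \<i> k" "h \<in> J" "k \<in> J" unfolding I_def by blast
      have "star (h + scaleC \<i> k) = h - scaleC \<i> k"
        using J_H[OF hk(2)] J_H[OF hk(3)] by (simp add: star_add star_scaleC hermitian_iff)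
      then have "h - scaleC \<i> k = 1" unfolding hk(1)[symmetric] by simp
      then have "1 + 1 = (h + scaleC \<i> k) + (h - scaleC \<i> k)" using hk(1) by simp
      then have "1 + 1 = h + h" by simp
      then have "1 + 1 \<in> J" using J_add[OF hk(2) hk(2)] by simp
      then have "1 \<cdot> 1 - (1 + 1) \<in> Q" unfolding J_def using zero_less_one by blast
      then show False using Q(2) by simp
    qed
    show "\<exists>c. a - scaleC c 1 \<in> I" for a
    proof -
      obtain h k where a: "h \<in> H" "k \<in> H" "a = h + scaleC \<i> k" by (rule cartesian_decomposition)
      obtain r s where "h - r \<cdot> 1 \<in> J" "k - s \<cdot> 1 \<in> J" using J_codim a by meson
      from II[OF this] have "a - scaleC (complex_of_real r + \<i> * complex_of_real s) 1 \<in> I"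
        by (simp add: a(3) rscale_def scale_right_diff_distrib scale_left_distrib algebra_simps)
      then show ?thesis by blast
    qed
  qed blast
  have "0 \<le> Re (\<alpha> x)" if "x \<in> M" for x
  proof (rule ccontr)
    have xQ: "x \<in> Q" using that Q(3) by blast
    obtain r where r: "x - r \<cdot> 1 \<in> J" using J_codim TQ(1)[OF xQ] by blast
    have "0 \<in> J" using J_mult[OF _ r, of 0] by simp
    from \<alpha>(2)[OF II[OF r this]] have \<alpha>x: "\<alpha> x = complex_of_real r"
      using star_linearD[OF characterD(1)[OF \<alpha>(1)]] characterD(3)[OF \<alpha>(1)] by simp
    assume "\<not> 0 \<le> Re (\<alpha> x)"
    then have "r < 0" using \<alpha>x by simp
    then have "(- r / 2) \<cdot> 1 - (x - r \<cdot> 1) \<in> Q" using r unfolding J_def by simp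
    from TQ(3)[OF this xQ] have "(- r / 2) \<cdot> 1 - (x - r \<cdot> 1) + x \<in> Q" .
    also have "(- r / 2) \<cdot> 1 - (x - r \<cdot> 1) + x = (- r / 2 + r) \<cdot> 1"
      unfolding rscale_add_left by simp
    finally show False using real_nonneg[of "- r / 2 + r"] \<open>r < 0\<close> by simp
  qed
  with \<alpha>(1) that show thesis by blast
qed

text \<open>No character is nonnegative on the module \<open>M - T * x\<close>, so \<open>M - T * x\<close> is not proper, which means
\<open>t * x - 1 \<in> M\<close> for some \<open>t \<in> T\<close>. With \<open>t\<close> bounded by a constant \<open>k\<close>, this relation improves
\<open>x + r \<in> M\<close> to \<open>x + r - 1 / k \<in> M\<close>. The archimedean property supplies a first \<open>r\<close>, and finitely many
improvements bring it down to \<open>0\<close>.\<close>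

theorem archimedean_positivstellensatz:
  assumes T: "archimedean_preprime T" and M: "preprime_module T M" and x: "x \<in> H"
    and pos: "\<And>\<alpha>. \<alpha> \<in> characters scaleC star \<Longrightarrow> (\<And>y. y \<in> M \<Longrightarrow> 0 \<le> Re (\<alpha> y)) \<Longrightarrow> 0 < Re (\<alpha> x)"
  shows "x \<in> M"
proof -
  note TM = preprime_moduleD[OF T M]
  define M' where "M' = {m - t * x |m t. m \<in> M \<and> t \<in> T}"
  have M'I: "m - t * x \<in> M'" if "m \<in> M" "t \<in> T" for m t using that M'_def by blast
  have M': "preprime_module T M'"
    unfolding preprime_module_def
  proof (intro conjI ballI)
    show "M' \<subseteq> H" using TM(1,2) x unfolding M'_def by auto
    show "1 \<in> M'" using M'I[OF TM(11,10)] by simp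
    fix a assume "a \<in> M'"
    then obtain m t where a: "a = m - t * x" "m \<in> M" "t \<in> T" unfolding M'_def by blast
    show "a + b \<in> M'" if b': "b \<in> M'" for b
    proof -
      obtain m' t' where b: "b = m' - t' * x" "m' \<in> M" "t' \<in> T" using b' unfolding M'_def by blast
      show ?thesis using M'I[OF TM(3)[OF a(2) b(2)] TM(13)[OF a(3) b(3)]]
        by (simp add: a(1) b(1) algebra_simps)
    qed
    show "s * a \<in> M'" if "s \<in> T" for s
      using M'I[OF TM(4)[OF that a(2)] TM(14)[OF that a(3)]] by (simp add: a(1) algebra_simps)
  qed
  have "- 1 \<in> M'"
  proof (rule ccontr)
    assume "- 1 \<notin> M'"
    then obtain \<alpha> where \<alpha>: "\<alpha> \<in> characters scaleC star" "\<And>y. y \<in> M' \<Longrightarrow> 0 \<le> Re (\<alpha> y)"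
      using proper_module_character[OF T M'] by blast
    have "y \<in> M'" if "y \<in> M" for y using M'I[OF that TM(10)] by simp
    then have "0 < Re (\<alpha> x)" by (intro pos \<alpha>) auto
    moreover have "0 \<le> Re (\<alpha> (- x))" using M'I[OF TM(9,12)] by (intro \<alpha>) auto
    ultimately show False using star_linearD(4)[OF characterD(1)[OF \<alpha>(1)], of x] by simp
  qed
  then obtain m t where mt: "- 1 = m - t * x" "m \<in> M" "t \<in> T" unfolding M'_def by blast
  have "t * x - 1 = t * x + - 1" by simp
  also have "\<dots> = m" unfolding mt(1) by simp
  finally have tx: "t * x - 1 \<in> M" using mt(2) by simp
  obtain k where k: "k > 0" "k \<cdot> 1 - t \<in> T" using archimedean_preprime_bound[OF T TM(2)[OF mt(3)]] by blast
  \<comment> \<open>\<open>(k - t) * (x + r) + (t * x - 1) + r * t = k * x + k * r - 1\<close>\<close>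
  have step: "x + (r - 1 / k) \<cdot> 1 \<in> M" if r: "x + r \<cdot> 1 \<in> M" "0 \<le> r" for r
  proof -
    have "(k \<cdot> 1 - t) * (x + r \<cdot> 1) + (t * x - 1) + r \<cdot> t \<in> M"
      by (rule TM(3)[OF TM(3)[OF TM(4)[OF k(2) r(1)] tx] TM(8)[OF TM(5)[OF mt(3)] r(2)]])
    then have "k \<cdot> x + (k * r) \<cdot> 1 - 1 \<in> M" by (simp add: algebra_simps)
    then have "(1 / k) \<cdot> (k \<cdot> x + (k * r) \<cdot> 1 - 1) \<in> M" using k(1) by (intro TM(8)) auto
    then show ?thesis using k(1) by (simp add: rscale_diff_left algebra_simps)
  qed
  have finish: "x \<in> M" if r: "x + r \<cdot> 1 \<in> M" "r \<le> 0" for r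
  proof -
    have "(- r) \<cdot> 1 \<in> M" using r(2) by (intro TM(6)) simp
    from TM(3)[OF r(1) this] show ?thesis by (simp add: rscale_minus_left)
  qed
  obtain r0 where r0: "r0 > 0" "r0 \<cdot> 1 + x \<in> T" using archimedean_preprime_bound[OF T x] by blast
  have iter: "x \<in> M \<or> x + (r0 - n / k) \<cdot> 1 \<in> M" for n :: nat
  proof (induction n)
    case 0
    then show ?case using TM(5)[OF r0(2)] by (simp add: add.commute)
  next
    case (Suc n)
    have next_r: "r0 - Suc n / k = r0 - n / k - 1 / k" by (simp add: add_divide_distrib)
    show ?case
      unfolding next_r using Suc step[of "r0 - n / k"] finish[of "r0 - n / k"] linear[of 0 "r0 - n / k"]
      by blast
  qed
  obtain n :: nat where "r0 * k < n" using reals_Archimedean2 by blast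
  then have "r0 - n / k \<le> 0" using k(1) by (simp add: field_simps)
  then show ?thesis using iter[of n] finish by blast
qed

end

section \<open>The closure of a power module\<close>

lemma topspace_seminorm_topology: "topspace (seminorm_topology \<phi>) = UNIV"
proof -
  have "openin (seminorm_topology \<phi>) UNIV"
    by (auto simp: openin_seminorm_topology intro: exI[of _ 1])
  then show ?thesis using openin_subset by blast
qed

locale seminormed_star_algebra = star_algebra scaleC star
  for scaleC :: "complex \<Rightarrow> 'a::{comm_ring, comm_monoid_mult} \<Rightarrow> 'a" and star +
  fixes \<phi> :: "'a \<Rightarrow> real"
  assumes seminorm: "submult_star_seminorm scaleC star \<phi>"
begin

lemma seminorm_simps [simp]:
  "0 \<le> \<phi> a" "\<phi> (scaleC c a) = cmod c * \<phi> a" "\<phi> (r \<cdot> a) = \<bar>r\<bar> * \<phi> a" "\<phi> (star a) = \<phi> a"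
  "\<phi> 0 = 0" "\<phi> (- a) = \<phi> a"
proof -
  show *: "0 \<le> \<phi> a" "\<phi> (scaleC c a) = cmod c * \<phi> a" "\<phi> (star a) = \<phi> a" for a c
    using seminorm by (auto simp: submult_star_seminorm_def)
  show "\<phi> (r \<cdot> a) = \<bar>r\<bar> * \<phi> a" by (simp add: rscale_def *(2))
  show "\<phi> 0 = 0" "\<phi> (- a) = \<phi> a" using *(2)[of 0 0] *(2)[of "-1" a] by simp_all
qed

lemma seminorm_add: "\<phi> (a + b) \<le> \<phi> a + \<phi> b"
  and seminorm_mult: "\<phi> (a * b) \<le> \<phi> a * \<phi> b"
  using seminorm by (auto simp: submult_star_seminorm_def)

lemma seminorm_power: "\<phi> (a ^ Suc n) \<le> \<phi> a ^ Suc n"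
proof (induction n)
  case (Suc n)
  have "\<phi> (a ^ Suc (Suc n)) \<le> \<phi> a * \<phi> (a ^ Suc n)" using seminorm_mult[of a "a ^ Suc n"] by simp
  also have "\<dots> \<le> \<phi> a * \<phi> a ^ Suc n" using Suc by (intro mult_left_mono) auto
  finally show ?case by simp
qed simp

definition herm_closure :: "'a set \<Rightarrow> 'a set"
  where "herm_closure S = {x \<in> H. \<forall>e>0. \<exists>s\<in>S. \<phi> (s - x) < e}"

lemma herm_closure_eq:
  assumes "S \<subseteq> H"
  shows "subtopology (seminorm_topology \<phi>) H closure_of S = herm_closure S"
proof -
  let ?T = "seminorm_topology \<phi>"
  have ball: "openin ?T {y. \<phi> (y - x) < e}" for x e
    unfolding openin_seminorm_topology
  proof (intro ballI)
    fix y assume "y \<in> {y. \<phi> (y - x) < e}"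
    moreover have "\<phi> (z - x) \<le> \<phi> (z - y) + \<phi> (y - x)" for z
      using seminorm_add[of "z - y" "y - x"] by simp
    ultimately show "\<exists>d>0. \<forall>z. \<phi> (z - y) < d \<longrightarrow> z \<in> {y. \<phi> (y - x) < e}"
      by (intro exI[of _ "e - \<phi> (y - x)"]) (auto, smt (verit))
  qed
  have "x \<in> ?T closure_of S \<longleftrightarrow> (\<forall>e>0. \<exists>s\<in>S. \<phi> (s - x) < e)" for x
  proof
    assume L: "x \<in> ?T closure_of S"
    show "\<forall>e>0. \<exists>s\<in>S. \<phi> (s - x) < e"
    proof (intro allI impI)
      fix e :: real assume "e > 0"
      define B where "B = {y. \<phi> (y - x) < e}"
      have "x \<in> B" "openin ?T B" using \<open>e > 0\<close> ball by (auto simp: B_def)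
      then have "\<exists>y. y \<in> S \<and> y \<in> B" using L unfolding in_closure_of by blast
      then show "\<exists>s\<in>S. \<phi> (s - x) < e" unfolding B_def by blast
    qed
  next
    assume R: "\<forall>e>0. \<exists>s\<in>S. \<phi> (s - x) < e"
    show "x \<in> ?T closure_of S"
      unfolding in_closure_of
    proof (intro conjI allI impI)
      fix U assume "x \<in> U \<and> openin ?T U"
      then obtain e where "e > 0" "\<forall>y. \<phi> (y - x) < e \<longrightarrow> y \<in> U"
        unfolding openin_seminorm_topology by blast
      then show "\<exists>y. y \<in> S \<and> y \<in> U" using R by blast
    qed (simp add: topspace_seminorm_topology)
  qed
  then show ?thesis using assms
    by (auto simp: closure_of_subtopology herm_closure_def Int_absorb1)
qed

lemma continuous_iff_bounded:
  assumes L: "star_linear scaleC star L"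
  shows "continuous_map (seminorm_topology \<phi>) euclidean L \<longleftrightarrow> (\<exists>C\<ge>0. \<forall>a. cmod (L a) \<le> C * \<phi> a)"
proof
  note lin = star_linearD[OF L]
  assume cont: "continuous_map (seminorm_topology \<phi>) euclidean L"
  have "openin (seminorm_topology \<phi>) {a \<in> topspace (seminorm_topology \<phi>). L a \<in> ball 0 1}"
    by (rule openin_continuous_map_preimage[OF cont]) (simp add: openin_open)
  then have "openin (seminorm_topology \<phi>) {a. cmod (L a) < 1}"
    by (simp add: topspace_seminorm_topology)
  moreover have "0 \<in> {a. cmod (L a) < 1}" using lin(3) by simp
  ultimately obtain e where e: "e > 0" "\<And>y. \<phi> y < e \<Longrightarrow> cmod (L y) < 1"
    unfolding openin_seminorm_topology by force
  have "cmod (L a) \<le> (1 / e) * \<phi> a" for a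
  proof (rule dense_ge)
    fix c assume c: "(1 / e) * \<phi> a < c"
    moreover have "0 \<le> (1 / e) * \<phi> a" using e(1) by simp
    ultimately have "c > 0" by linarith
    have "\<phi> ((1 / c) \<cdot> a) < e" using c e(1) \<open>c > 0\<close> by (simp add: field_simps)
    from e(2)[OF this] show "cmod (L a) \<le> c"
      using \<open>c > 0\<close> by (simp add: lin(6) norm_mult norm_divide field_simps)
  qed
  then show "\<exists>C\<ge>0. \<forall>a. cmod (L a) \<le> C * \<phi> a" using e(1) by (intro exI[of _ "1 / e"]) auto
next
  note lin = star_linearD[OF L]
  assume "\<exists>C\<ge>0. \<forall>a. cmod (L a) \<le> C * \<phi> a"
  then obtain C where C: "C \<ge> 0" "\<And>a. cmod (L a) \<le> C * \<phi> a" by blast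
  show "continuous_map (seminorm_topology \<phi>) euclidean L"
    unfolding continuous_map_def
  proof (intro conjI allI impI)
    fix U :: "complex set" assume "openin euclidean U"
    then have U: "open U" by (simp add: openin_open)
    show "openin (seminorm_topology \<phi>) {x \<in> topspace (seminorm_topology \<phi>). L x \<in> U}"
      unfolding openin_seminorm_topology topspace_seminorm_topology
    proof (intro ballI)
      fix x assume "x \<in> {x \<in> UNIV. L x \<in> U}"
      then obtain e where e: "e > 0" "\<And>z. dist z (L x) < e \<Longrightarrow> z \<in> U"
        using U unfolding open_dist by force
      have "L y \<in> U" if "\<phi> (y - x) < e / (C + 1)" for y
      proof (rule e(2))
        have "dist (L y) (L x) \<le> C * \<phi> (y - x)" using C(2)[of "y - x"] by (simp add: dist_norm lin(2))
        also have "\<dots> \<le> (C + 1) * \<phi> (y - x)" by (simp add: mult_right_mono)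
        also have "\<dots> < e" using that C(1) by (simp add: field_simps)
        finally show "dist (L y) (L x) < e" .
      qed
      then show "\<exists>e>0. \<forall>y. \<phi> (y - x) < e \<longrightarrow> y \<in> {x \<in> UNIV. L x \<in> U}"
        using e(1) C(1) by (intro exI[of _ "e / (C + 1)"]) auto
    qed
  qed simp
qed

lemma power_remainder_bound:
  "\<exists>K\<ge>0. \<forall>x. \<phi> x \<le> 1 \<longrightarrow> \<phi> ((1 + x) ^ m - 1 - real m \<cdot> x) \<le> K * (\<phi> x)\<^sup>2"
proof (induction m)
  case 0
  show ?case by (intro exI[of _ 0]) simp
next
  case (Suc m)
  then obtain K where K: "K \<ge> 0" "\<And>x. \<phi> x \<le> 1 \<Longrightarrow> \<phi> ((1 + x) ^ m - 1 - real m \<cdot> x) \<le> K * (\<phi> x)\<^sup>2" by blast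
  have "\<phi> ((1 + x) ^ Suc m - 1 - real (Suc m) \<cdot> x) \<le> (m + 2 * K) * (\<phi> x)\<^sup>2" if x: "\<phi> x \<le> 1" for x
  proof -
    define R where "R = (1 + x) ^ m - 1 - real m \<cdot> x"
    have R: "(1 + x) ^ m = R + 1 + real m \<cdot> x" by (simp add: R_def)
    have "(1 + x) ^ Suc m - 1 - real (Suc m) \<cdot> x = real m \<cdot> (x * x) + (R + x * R)"
      by (simp add: R rscale_add_left algebra_simps)
    also have "\<phi> \<dots> \<le> m * \<phi> (x * x) + (\<phi> R + \<phi> (x * R))"
      using seminorm_add[of "real m \<cdot> (x * x)" "R + x * R"] seminorm_add[of R "x * R"] by simp
    also have "\<dots> \<le> m * (\<phi> x * \<phi> x) + (\<phi> R + 1 * \<phi> R)"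
      using seminorm_mult[of x x] order_trans[OF seminorm_mult[of x R] mult_right_mono[OF x]]
      by (intro add_mono mult_left_mono) auto
    also have "\<dots> \<le> (m + 2 * K) * (\<phi> x)\<^sup>2"
    proof -
      have "\<phi> R \<le> K * (\<phi> x)\<^sup>2" using K(2)[OF x] by (simp only: R_def)
      then show ?thesis by (simp add: power2_eq_square algebra_simps)
    qed
    finally show ?thesis .
  qed
  then show ?case using K(1) by (intro exI[of _ "m + 2 * K"]) auto
qed

text \<open>Half of the \<open>m\<close>-th power of \<open>1 + (2 / m) \<cdot> x\<close> agrees with \<open>1/2 + x\<close> up to an error that is quadratic in
\<open>\<phi> x\<close>. For small \<open>\<delta>\<close> the missing part is \<open>1/2 \<cdot> (1 + y)\<close> with \<open>y\<close> again in the ball of radius \<open>\<delta>\<close>, so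
the step can be repeated. After \<open>n\<close> steps, \<open>1 + x\<close> is an element of the cone plus a remainder of size
\<open>O(1 / 2\<^sup>n)\<close>. This replaces the binomial series for the \<open>m\<close>-th root of \<open>1 + x\<close>.\<close>

lemma one_plus_small_in_closed_cone:
  assumes m: "m \<ge> 1" and T: "T \<subseteq> H" "0 \<in> T" "\<And>s t. s \<in> T \<Longrightarrow> t \<in> T \<Longrightarrow> s + t \<in> T"
    "\<And>r t. 0 \<le> r \<Longrightarrow> t \<in> T \<Longrightarrow> r \<cdot> t \<in> T" and power: "\<And>a. a \<in> H \<Longrightarrow> a ^ m \<in> T"
    and closed: "herm_closure T \<subseteq> T"
  shows "\<exists>\<delta>>0. \<forall>x\<in>H. \<phi> x \<le> \<delta> \<longrightarrow> 1 + x \<in> T"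
proof -
  obtain K where K: "K \<ge> 0" "\<And>x. \<phi> x \<le> 1 \<Longrightarrow> \<phi> ((1 + x) ^ m - 1 - real m \<cdot> x) \<le> K * (\<phi> x)\<^sup>2"
    using power_remainder_bound[of m] by blast
  \<comment> \<open>this radius gives \<open>K * (2 * \<delta>)\<^sup>2 \<le> \<delta>\<close>, and \<open>2 * \<delta> \<le> 1\<close> keeps \<open>(2 / m) \<cdot> x\<close> in the unit ball\<close>
  define \<delta> where "\<delta> = 1 / (4 * K + 2)"
  have \<delta>: "\<delta> > 0" "2 * \<delta> \<le> 1" "4 * K * \<delta> \<le> 1" using K(1) by (auto simp: \<delta>_def field_simps)
  have halve: "\<exists>a\<in>H. \<exists>y\<in>H. \<phi> y \<le> \<delta> \<and> 1 + x = (1/2) \<cdot> a ^ m + (1/2) \<cdot> (1 + y)"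
    if x: "x \<in> H" "\<phi> x \<le> \<delta>" for x
  proof -
    define x' where "x' = (2 / m) \<cdot> x"
    define y where "y = - ((1 + x') ^ m - 1 - real m \<cdot> x')"
    have "(2 / m) * \<phi> x \<le> 2 * \<delta>" using m x(2) \<delta>(1) by (intro mult_mono) (auto simp: field_simps)
    then have x': "\<phi> x' \<le> 2 * \<delta>" by (simp add: x'_def)
    have "\<phi> y = \<phi> ((1 + x') ^ m - 1 - real m \<cdot> x')" unfolding y_def by (rule seminorm_simps(6))
    also have "\<dots> \<le> K * (\<phi> x')\<^sup>2" using x' \<delta>(2) by (intro K(2)) simp
    also have "\<dots> \<le> K * (2 * \<delta>)\<^sup>2" using x' K(1) by (intro mult_left_mono power_mono) auto
    also have "\<dots> = (4 * K * \<delta>) * \<delta>" by (simp add: power2_eq_square)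
    also have "\<dots> \<le> \<delta>" using \<delta> by (simp add: mult_left_le_one_le K(1))
    finally have "\<phi> y \<le> \<delta>" .
    moreover have "y \<in> H" "1 + x' \<in> H" using x(1) by (auto simp: y_def x'_def)
    moreover have "1 + x = (1/2) \<cdot> (1 + x') ^ m + (1/2) \<cdot> (1 + y)"
    proof -
      have "(1/2) \<cdot> (1 + x') ^ m + (1/2) \<cdot> (1 + y) = ((1/2) \<cdot> 1 + (1/2) \<cdot> 1) + (1/2 * m) \<cdot> x'"
        by (simp add: y_def algebra_simps)
      also have "(1/2) \<cdot> 1 + (1/2) \<cdot> 1 = 1" using rscale_add_left[of "1/2" "1/2" 1] by simp
      also have "(1/2 * m) \<cdot> x' = x" using m by (simp add: x'_def)
      finally show ?thesis by simp
    qed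
    ultimately show ?thesis by blast
  qed
  have "1 + x \<in> T" if x: "x \<in> H" "\<phi> x \<le> \<delta>" for x
  proof -
    have approx: "\<exists>t\<in>T. \<exists>y\<in>H. \<phi> y \<le> \<delta> \<and> 1 + x = t + ((1/2) ^ n) \<cdot> (1 + y)" for n
    proof (induction n)
      case 0
      show ?case using x T(2) by (intro bexI[of _ 0] bexI[of _ x]) auto
    next
      case (Suc n)
      then obtain t y where t: "t \<in> T" "y \<in> H" "\<phi> y \<le> \<delta>" "1 + x = t + ((1/2) ^ n) \<cdot> (1 + y)" by blast
      obtain a z where a: "a \<in> H" "z \<in> H" "\<phi> z \<le> \<delta>" "1 + y = (1/2) \<cdot> a ^ m + (1/2) \<cdot> (1 + z)"
        using halve[OF t(2,3)] by blast
      have "1 + x = (t + ((1/2) ^ n * (1/2)) \<cdot> a ^ m) + ((1/2) ^ Suc n) \<cdot> (1 + z)"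
        unfolding t(4) a(4) by (simp add: algebra_simps)
      moreover have "t + ((1/2) ^ n * (1/2)) \<cdot> a ^ m \<in> T" by (intro T(3,4) t(1) power a(1)) simp
      ultimately show ?case using a(2,3) by blast
    qed
    have "\<exists>t\<in>T. \<phi> (t - (1 + x)) < e" if e: "e > 0" for e
    proof -
      have "(\<lambda>n. (1/2) ^ n * (\<phi> 1 + \<delta>)) \<longlonglongrightarrow> 0 * (\<phi> 1 + \<delta>)"
        by (intro tendsto_mult LIMSEQ_power_zero tendsto_const) simp
      then have "\<forall>\<^sub>F n in sequentially. (1/2) ^ n * (\<phi> 1 + \<delta>) < e" using e by (intro order_tendstoD) auto
      then obtain n where n: "(1/2) ^ n * (\<phi> 1 + \<delta>) < e" unfolding eventually_sequentially by blast
      obtain t y where t: "t \<in> T" "y \<in> H" "\<phi> y \<le> \<delta>" "1 + x = t + ((1/2) ^ n) \<cdot> (1 + y)"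
        using approx[of n] by blast
      have "\<phi> (t - (1 + x)) = (1/2) ^ n * \<phi> (1 + y)" unfolding t(4)
        using seminorm_simps(3)[of "(1/2) ^ n" "1 + y"] seminorm_simps(6)[of "((1/2) ^ n) \<cdot> (1 + y)"]
        by (simp del: rscale_simps seminorm_simps)
      also have "\<dots> \<le> (1/2) ^ n * (\<phi> 1 + \<delta>)"
        using seminorm_add[of 1 y] t(3) by (intro mult_left_mono) auto
      also note n
      finally show ?thesis using t(1) by blast
    qed
    then have "1 + x \<in> herm_closure T" using x by (auto simp: herm_closure_def)
    then show ?thesis using closed by blast
  qed
  then show ?thesis using \<delta>(1) by blast
qed

text \<open>Multipliers serve as the preprime that acts on \<open>M\<close>. Stability under sums and products comes
for free, whereas sums of \<open>2d\<close>-th powers would have to be multiplied out and closed up.\<close>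

definition multipliers :: "'a set \<Rightarrow> 'a set"
  where "multipliers M = {t \<in> H. \<forall>x\<in>M. t * x \<in> M}"

lemma herm_closureE:
  assumes "x \<in> herm_closure S" "e > 0"
  obtains s where "s \<in> S" "\<phi> (s - x) < e"
  using assms unfolding herm_closure_def by blast

lemma subset_herm_closure: "S \<subseteq> H \<Longrightarrow> S \<subseteq> herm_closure S"
  unfolding herm_closure_def by force

lemma herm_closure_herm: "herm_closure S \<subseteq> H"
  unfolding herm_closure_def by blast

lemma herm_closure_idem: "herm_closure (herm_closure S) \<subseteq> herm_closure S"
proof
  fix x assume x: "x \<in> herm_closure (herm_closure S)"
  have "\<exists>s\<in>S. \<phi> (s - x) < e" if e: "e > 0" for e
  proof -
    obtain y where y: "y \<in> herm_closure S" "\<phi> (y - x) < e / 2"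
      using herm_closureE[OF x, of "e/2"] e by auto
    obtain s where s: "s \<in> S" "\<phi> (s - y) < e / 2"
      using herm_closureE[OF y(1), of "e/2"] e by auto
    have "\<phi> (s - x) \<le> \<phi> (s - y) + \<phi> (y - x)" using seminorm_add[of "s - y" "y - x"] by simp
    then show ?thesis using y(2) s by (intro bexI[of _ s]) auto
  qed
  then show "x \<in> herm_closure S" using x by (auto simp: herm_closure_def)
qed

lemma herm_closure_mult:
  assumes "t \<in> H" "\<And>s. s \<in> S \<Longrightarrow> t * s \<in> S'" "x \<in> herm_closure S"
  shows "t * x \<in> herm_closure S'"
  unfolding herm_closure_def
proof (intro CollectI conjI allI impI)
  show "t * x \<in> H" using assms(1,3) herm_closure_herm by blast
  fix e :: real assume e: "e > 0"
  have pos: "\<phi> t + 1 > 0" by (simp add: add_nonneg_pos)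
  obtain s where s: "s \<in> S" "\<phi> (s - x) < e / (\<phi> t + 1)"
    using herm_closureE[OF assms(3), of "e / (\<phi> t + 1)"] e pos by auto
  have "\<phi> (t * s - t * x) \<le> \<phi> t * \<phi> (s - x)" using seminorm_mult[of t "s - x"] by (simp add: algebra_simps)
  also have "\<dots> \<le> (\<phi> t + 1) * \<phi> (s - x)" by (intro mult_right_mono) auto
  also have "\<dots> < e" using s(2) pos by (simp add: field_simps)
  finally show "\<exists>s\<in>S'. \<phi> (s - t * x) < e" using assms(2)[OF s(1)] by blast
qed

lemma herm_closure_add:
  assumes "\<And>s t. s \<in> S \<Longrightarrow> t \<in> S \<Longrightarrow> s + t \<in> S" "x \<in> herm_closure S" "y \<in> herm_closure S"
  shows "x + y \<in> herm_closure S"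
  unfolding herm_closure_def
proof (intro CollectI conjI allI impI)
  show "x + y \<in> H" using assms(2,3) herm_closure_herm by blast
  fix e :: real assume "e > 0"
  then obtain s t where st: "s \<in> S" "\<phi> (s - x) < e / 2" "t \<in> S" "\<phi> (t - y) < e / 2"
    using herm_closureE[OF assms(2), of "e/2"] herm_closureE[OF assms(3), of "e/2"] by (metis half_gt_zero)
  have "\<phi> ((s + t) - (x + y)) \<le> \<phi> (s - x) + \<phi> (t - y)"
    using seminorm_add[of "s - x" "t - y"] by (simp add: algebra_simps)
  then show "\<exists>s\<in>S. \<phi> (s - (x + y)) < e" using st assms(1)[OF st(1,3)] by (intro bexI[of _ "s + t"]) auto
qed

lemma multipliers_closed:
  assumes "herm_closure M \<subseteq> M" "M \<subseteq> H"
  shows "herm_closure (multipliers M) \<subseteq> multipliers M"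
proof
  fix t assume t: "t \<in> herm_closure (multipliers M)"
  have "t * x \<in> M" if x: "x \<in> M" for x
  proof -
    have "x * t \<in> herm_closure M"
    proof (rule herm_closure_mult[OF _ _ t])
      show "x \<in> H" using x assms(2) by blast
      show "x * s \<in> M" if "s \<in> multipliers M" for s
        using that x mult.commute[of x s] by (simp add: multipliers_def)
    qed
    then show ?thesis using assms(1) mult.commute[of t x] by auto
  qed
  then show "t \<in> multipliers M" using t herm_closure_herm by (auto simp: multipliers_def)
qed

lemma rscale_power: "(r \<cdot> a) ^ n = (r ^ n) \<cdot> a ^ n"
  by (induction n) (auto simp: mult_ac)

text \<open>The set of multipliers of the closure is a closed cone that contains all \<open>2d\<close>-th powers of hermitian
elements. It therefore contains \<open>1 + x\<close> for all small hermitian \<open>x\<close>, and scaling makes it archimedean.\<close>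

lemma power_module_closure:
  assumes d: "d \<ge> 1" and S: "power_module star d S"
  shows "preprime_module (multipliers (herm_closure S)) (herm_closure S)"
    and "archimedean_preprime (multipliers (herm_closure S))"
    and "\<exists>\<delta>>0. \<forall>x\<in>H. \<phi> x \<le> \<delta> \<longrightarrow> 1 + x \<in> herm_closure S"
proof -
  define M where "M = herm_closure S"
  define T where "T = multipliers M"
  note Sdefs = S[unfolded power_module_def]
  have SM: "S \<subseteq> M" and MH: "M \<subseteq> H" and Mcl: "herm_closure M \<subseteq> M" and TH: "T \<subseteq> H"
    unfolding M_def T_def multipliers_def
    using subset_herm_closure herm_closure_herm herm_closure_idem Sdefs by auto
  have M1: "1 \<in> M" using SM Sdefs by blast
  have Madd: "x + y \<in> M" if "x \<in> M" "y \<in> M" for x y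
    using that Sdefs unfolding M_def by (intro herm_closure_add) auto
  have TI: "t \<in> T" if "t \<in> H" "\<And>x. x \<in> M \<Longrightarrow> t * x \<in> M" for t using that by (simp add: T_def multipliers_def)
  have TM: "t * x \<in> M" if "t \<in> T" "x \<in> M" for t x using that by (simp add: T_def multipliers_def)
  have Tpow: "a ^ (2 * d) \<in> T" if "a \<in> H" for a
  proof (rule TI)
    show "a ^ (2 * d) * x \<in> M" if "x \<in> M" for x
      unfolding M_def by (rule herm_closure_mult[of _ S]) (use that \<open>a \<in> H\<close> Sdefs M_def in auto)
  qed (use that in auto)
  have Tadd: "s + t \<in> T" if "s \<in> T" "t \<in> T" for s t
    using that TH by (intro TI) (auto simp: distrib_right intro!: Madd TM)
  have Tmult: "s * t \<in> T" if "s \<in> T" "t \<in> T" for s t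
    using that TH by (intro TI) (auto simp: mult.assoc intro!: TM)
  have Treal: "r \<cdot> 1 \<in> T" if "0 \<le> r" for r
    \<comment> \<open>a nonnegative real is the \<open>2d\<close>-th power of its real root\<close>
    using Tpow[of "root (2 * d) r \<cdot> 1"] that d by (simp add: rscale_power real_root_pow_pos2)
  have Tscale: "r \<cdot> t \<in> T" if "0 \<le> r" "t \<in> T" for r t
    using Tmult[OF Treal[OF that(1)] that(2)] by simp
  have TsubM: "T \<subseteq> M" using TM[OF _ M1] by auto
  have T0: "0 \<in> T" using Treal[of 0] by simp
  have Tcl: "herm_closure T \<subseteq> T" unfolding T_def by (rule multipliers_closed[OF Mcl MH])
  obtain \<delta> where \<delta>: "\<delta> > 0" "\<And>x. x \<in> H \<Longrightarrow> \<phi> x \<le> \<delta> \<Longrightarrow> 1 + x \<in> T"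
    using one_plus_small_in_closed_cone[of "2 * d" T, OF _ TH T0 Tadd Tscale Tpow Tcl] d by auto
  then show "\<exists>\<delta>>0. \<forall>x\<in>H. \<phi> x \<le> \<delta> \<longrightarrow> 1 + x \<in> herm_closure S"
    using TsubM unfolding M_def by blast
  have "\<exists>r. r \<cdot> 1 + x \<in> T" if x: "x \<in> H" for x
  proof -
    define r where "r = \<phi> x / \<delta> + 1"
    have r: "r > 0" using \<delta>(1) by (simp add: r_def add_nonneg_pos)
    have "\<phi> ((1 / r) \<cdot> x) \<le> \<delta>" using r \<delta>(1) by (simp add: field_simps r_def)
    then have "r \<cdot> (1 + (1 / r) \<cdot> x) \<in> T" using x r by (intro Tscale \<delta>) auto
    then show ?thesis using r by auto
  qed
  then show "archimedean_preprime (multipliers (herm_closure S))"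
    unfolding archimedean_preprime_def M_def[symmetric] T_def[symmetric]
    using TH Tadd Tmult Treal by blast
  show "preprime_module (multipliers (herm_closure S)) (herm_closure S)"
    unfolding preprime_module_def M_def[symmetric] T_def[symmetric]
    using MH M1 Madd TM by blast
qed

lemma star_linear_nonneg_iff:
  assumes "star_linear scaleC star L" "a \<in> H"
  shows "L a \<in> \<real>\<^sub>\<ge>\<^sub>0 \<longleftrightarrow> 0 \<le> Re (L a)"
proof -
  have "Im (L a) = 0" using star_linearD(8)[OF assms] by (metis Im_complex_of_real)
  then show ?thesis by (simp add: complex_nonneg_Reals_iff)
qed

lemma norm_sq_character:
  assumes "\<alpha> \<in> characters scaleC star"
  shows "\<alpha> (a * star a) = complex_of_real ((cmod (\<alpha> a))\<^sup>2)"
  unfolding characterD(2)[OF assms] star_linearD(7)[OF characterD(1)[OF assms]]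
  by (rule complex_norm_square[symmetric])

text \<open>A bound \<open>cmod (\<alpha> a) \<le> C * \<phi> a\<close> improves to \<open>C = 1\<close> when it is applied to the powers of \<open>a\<close>.\<close>

lemma gelfand_spectrum_eq:
  "gelfand_spectrum scaleC star \<phi> = {\<alpha> \<in> characters scaleC star. \<forall>a. cmod (\<alpha> a) \<le> \<phi> a}"
proof -
  have "cmod (\<alpha> a) \<le> \<phi> a"
    if \<alpha>: "\<alpha> \<in> characters scaleC star" and C: "C \<ge> 0" "\<And>a. cmod (\<alpha> a) \<le> C * \<phi> a" for \<alpha> C a
  proof (rule ccontr)
    assume "\<not> cmod (\<alpha> a) \<le> \<phi> a"
    then have less: "\<phi> a < cmod (\<alpha> a)" by simp
    define q where "q = \<phi> a / cmod (\<alpha> a)"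
    have pos: "cmod (\<alpha> a) > 0" using less seminorm_simps(1)[of a] by linarith
    have q: "0 \<le> q" "q < 1" using less pos by (auto simp: q_def)
    have bound: "1 \<le> C * q ^ Suc n" for n
    proof -
      have "cmod (\<alpha> a) ^ Suc n = cmod (\<alpha> (a ^ Suc n))" by (simp only: characterD(4)[OF \<alpha>] norm_power)
      also have "\<dots> \<le> C * \<phi> (a ^ Suc n)" by (rule C)
      also have "\<dots> \<le> C * \<phi> a ^ Suc n" by (intro mult_left_mono seminorm_power C)
      finally show ?thesis using pos by (simp add: q_def power_divide field_simps)
    qed
    have "(\<lambda>n. C * q ^ Suc n) \<longlonglongrightarrow> C * 0"
      using q by (intro tendsto_mult tendsto_const LIMSEQ_Suc LIMSEQ_power_zero) auto
    from LIMSEQ_le_const[OF this, of 1] bound show False by auto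
  qed
  then show ?thesis
    unfolding gelfand_spectrum_def
    using continuous_iff_bounded[OF characterD(1)] by (auto intro!: exI[of _ 1])
qed

lemma continuous_nonneg_on_closure:
  assumes L: "star_linear scaleC star L" "continuous_map (seminorm_topology \<phi>) euclidean L"
    and S: "\<And>s. s \<in> S \<Longrightarrow> L s \<in> \<real>\<^sub>\<ge>\<^sub>0" and x: "x \<in> herm_closure S"
  shows "0 \<le> Re (L x)"
proof (rule ccontr)
  obtain C where C: "C \<ge> 0" "\<And>a. cmod (L a) \<le> C * \<phi> a" using L continuous_iff_bounded by blast
  assume neg: "\<not> 0 \<le> Re (L x)"
  define e where "e = - Re (L x) / (C + 1)"
  have "e > 0" using neg C(1) by (simp add: e_def divide_neg_pos)
  then obtain s where s: "s \<in> S" "\<phi> (s - x) < e" using herm_closureE[OF x] by blast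
  have "0 \<le> Re (L s)" using S[OF s(1)] by (simp add: complex_nonneg_Reals_iff)
  then have "- Re (L x) \<le> Re (L (s - x))" using star_linearD(2)[OF L(1)] by simp
  also have "\<dots> \<le> C * \<phi> (s - x)" using C(2)[of "s - x"] complex_Re_le_cmod order_trans by blast
  also have "\<dots> \<le> (C + 1) * \<phi> (s - x)" by (simp add: mult_right_mono)
  also have "\<dots> < (C + 1) * e" using s(2) C(1) by simp
  also have "\<dots> = - Re (L x)" using C(1) by (simp add: e_def)
  finally show False by simp
qed

text \<open>Nonnegativity on \<open>1 + x\<close> for small \<open>x\<close> bounds the character on hermitian elements. The identity
\<open>\<alpha> (a * star a) = (cmod (\<alpha> a))\<^sup>2\<close> carries this bound over to all elements.\<close>

lemma character_nonneg_on_closure: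
  assumes d: "d \<ge> 1" and S: "power_module star d S"
    and \<alpha>: "\<alpha> \<in> characters scaleC star" and nonneg: "\<And>y. y \<in> herm_closure S \<Longrightarrow> 0 \<le> Re (\<alpha> y)"
  shows "\<alpha> \<in> nonneg_characters scaleC star S \<inter> gelfand_spectrum scaleC star \<phi>"
proof
  note lin = star_linearD[OF characterD(1)[OF \<alpha>]]
  have SH: "S \<subseteq> H" using S by (simp add: power_module_def)
  show "\<alpha> \<in> nonneg_characters scaleC star S"
    unfolding nonneg_characters_def
  proof (intro CollectI conjI ballI \<alpha>)
    fix s assume s: "s \<in> S"
    then have "0 \<le> Re (\<alpha> s)" using nonneg subset_herm_closure[OF SH] by blast
    then show "\<alpha> s \<in> \<real>\<^sub>\<ge>\<^sub>0" using s SH star_linear_nonneg_iff[OF characterD(1)[OF \<alpha>]] by blast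
  qed
  obtain \<delta> where \<delta>: "\<delta> > 0" "\<And>x. x \<in> H \<Longrightarrow> \<phi> x \<le> \<delta> \<Longrightarrow> 1 + x \<in> herm_closure S"
    using power_module_closure(3)[OF d S] by blast
  have small: "- 1 \<le> Re (\<alpha> x)" if "x \<in> H" "\<phi> x \<le> \<delta>" for x
    using nonneg[OF \<delta>(2)[OF that]] by (simp add: lin characterD(3)[OF \<alpha>])
  have herm: "Re (\<alpha> h) \<le> (1 / \<delta>) * \<phi> h" if h: "h \<in> H" for h
  proof (rule dense_ge)
    fix c assume c: "(1 / \<delta>) * \<phi> h < c"
    moreover have "0 \<le> (1 / \<delta>) * \<phi> h" using \<delta>(1) by simp
    ultimately have "c > 0" by linarith
    then have "\<phi> ((- 1 / c) \<cdot> h) \<le> \<delta>" using c \<delta>(1) by (simp add: field_simps)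
    then have "- 1 \<le> Re (\<alpha> ((- 1 / c) \<cdot> h))" using h by (intro small) auto
    then show "Re (\<alpha> h) \<le> c" using \<open>c > 0\<close> unfolding lin(6) by (simp add: field_simps)
  qed
  define C where "C = sqrt (1 / \<delta>)"
  have C2: "C\<^sup>2 = 1 / \<delta>" using \<delta>(1) by (simp add: C_def)
  have "cmod (\<alpha> a) \<le> C * \<phi> a" for a
  proof (rule power2_le_imp_le)
    have "(cmod (\<alpha> a))\<^sup>2 = Re (\<alpha> (a * star a))" by (simp add: norm_sq_character[OF \<alpha>])
    also have "\<dots> \<le> (1 / \<delta>) * \<phi> (a * star a)"
      by (intro herm) (simp add: hermitian_iff star_mult star_star mult.commute)
    also have "\<dots> \<le> (1 / \<delta>) * (\<phi> a * \<phi> a)"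
      using seminorm_mult[of a "star a"] \<delta>(1) by (intro mult_left_mono) auto
    also have "\<dots> = (C * \<phi> a)\<^sup>2" by (simp add: power_mult_distrib C2 power2_eq_square[of "\<phi> a"])
    finally show "(cmod (\<alpha> a))\<^sup>2 \<le> (C * \<phi> a)\<^sup>2" .
    show "0 \<le> C * \<phi> a" using \<delta>(1) by (simp add: C_def)
  qed
  moreover have "C \<ge> 0" using \<delta>(1) by (simp add: C_def)
  ultimately show "\<alpha> \<in> gelfand_spectrum scaleC star \<phi>"
    unfolding gelfand_spectrum_def using \<alpha> continuous_iff_bounded[OF characterD(1)[OF \<alpha>]] by blast
qed

text \<open>A hermitian element that is nonnegative at the characters in question becomes strictly positive at them after adding
a small constant, hence lies in the closure of \<open>S\<close>. Letting the constant tend to \<open>0\<close> stays in the closure.\<close>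

theorem herm_closure_eq_Pos:
  assumes d: "d \<ge> 1" and S: "power_module star d S"
  shows "herm_closure S = Pos star (nonneg_characters scaleC star S \<inter> gelfand_spectrum scaleC star \<phi>)"
    (is "_ = Pos star ?K")
proof
  show "herm_closure S \<subseteq> Pos star ?K"
  proof
    fix x assume x: "x \<in> herm_closure S"
    then have xH: "x \<in> H" using herm_closure_herm by blast
    have "\<alpha> x \<in> \<real>\<^sub>\<ge>\<^sub>0" if "\<alpha> \<in> ?K" for \<alpha>
    proof -
      have \<alpha>: "\<alpha> \<in> characters scaleC star" "continuous_map (seminorm_topology \<phi>) euclidean \<alpha>"
        "\<And>s. s \<in> S \<Longrightarrow> \<alpha> s \<in> \<real>\<^sub>\<ge>\<^sub>0"
        using that by (auto simp: nonneg_characters_def gelfand_spectrum_def)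
      then show ?thesis
        using continuous_nonneg_on_closure[OF characterD(1) _ _ x] star_linear_nonneg_iff[OF characterD(1) xH]
        by blast
    qed
    then show "x \<in> Pos star ?K" using xH by (simp add: Pos_def)
  qed
  show "Pos star ?K \<subseteq> herm_closure S"
  proof
    fix x assume "x \<in> Pos star ?K"
    then have x: "x \<in> H" "\<And>\<alpha>. \<alpha> \<in> ?K \<Longrightarrow> \<alpha> x \<in> \<real>\<^sub>\<ge>\<^sub>0" by (auto simp: Pos_def)
    have "\<exists>s\<in>herm_closure S. \<phi> (s - x) < e" if e: "e > 0" for e
    proof -
      have pos: "\<phi> 1 + 1 > 0" by (simp add: add_nonneg_pos)
      define r where "r = e / (\<phi> 1 + 1)"
      have r: "r > 0" using e pos by (simp add: r_def)
      have "x + r \<cdot> 1 \<in> herm_closure S"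
      proof (rule archimedean_positivstellensatz[OF power_module_closure(2,1)[OF d S]])
        fix \<alpha> assume \<alpha>: "\<alpha> \<in> characters scaleC star" "\<And>y. y \<in> herm_closure S \<Longrightarrow> 0 \<le> Re (\<alpha> y)"
        note lin = star_linearD[OF characterD(1)[OF \<alpha>(1)]]
        have "0 \<le> Re (\<alpha> x)" using x(2)[OF character_nonneg_on_closure[OF d S \<alpha>]]
          by (simp add: complex_nonneg_Reals_iff)
        then show "0 < Re (\<alpha> (x + r \<cdot> 1))" using r by (simp add: lin characterD(3)[OF \<alpha>(1)])
      qed (use x in auto)
      moreover have "\<phi> (x + r \<cdot> 1 - x) < e" using r pos e by (simp add: r_def field_simps)
      ultimately show ?thesis by blast
    qed
    then have "x \<in> herm_closure (herm_closure S)" using x by (auto simp: herm_closure_def[of "herm_closure S"])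
    then show "x \<in> herm_closure S" using herm_closure_idem by blast
  qed
qed

end

section \<open>Compactness of the spectrum and density of the Gelfand transforms\<close>

text \<open>Separation axioms pass to products over arbitrary index types: two functions that differ at a point
are separated by open conditions on their values there. The Stone-Weierstrass theorem
is stated for the class of \<open>T\<^sub>2\<close> spaces, and the weaker axioms have to be declared first for the
subclass chain to be respected.\<close>

instance "fun" :: (type, t0_space) t0_space
proof
  fix f g :: "'a \<Rightarrow> 'b"
  assume "f \<noteq> g"
  then obtain x where "f x \<noteq> g x" by auto
  then obtain U where "open U" "\<not> (f x \<in> U \<longleftrightarrow> g x \<in> U)"
    by (auto simp: separation_t0)
  then show "\<exists>U. open U \<and> \<not> (f \<in> U \<longleftrightarrow> g \<in> U)"
    by (intro exI[of _ "(\<lambda>h. h x) -` U"]) (auto intro!: open_vimage continuous_on_product_coordinates)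
qed

instance "fun" :: (type, t1_space) t1_space
proof
  fix f g :: "'a \<Rightarrow> 'b"
  assume "f \<noteq> g"
  then obtain x where "f x \<noteq> g x" by auto
  then obtain U where "open U" "f x \<in> U" "g x \<notin> U"
    by (auto simp: separation_t1)
  then show "\<exists>U. open U \<and> f \<in> U \<and> g \<notin> U"
    by (intro exI[of _ "(\<lambda>h. h x) -` U"]) (auto intro!: open_vimage continuous_on_product_coordinates)
qed

instance "fun" :: (type, t2_space) t2_space
proof
  fix f g :: "'a \<Rightarrow> 'b"
  assume "f \<noteq> g"
  then obtain x where "f x \<noteq> g x" by auto
  then obtain U V where UV: "open U" "open V" "f x \<in> U" "g x \<in> V" "U \<inter> V = {}"
    by (auto simp: separation_t2)
  have "open ((\<lambda>h. h x) -` U)" "open ((\<lambda>h. h x) -` V)"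
    using UV(1,2) by (auto intro!: open_vimage continuous_on_product_coordinates)
  with UV(3-) show "\<exists>U V. open U \<and> open V \<and> f \<in> U \<and> g \<in> V \<and> U \<inter> V = {}"
    by (intro exI[of _ "(\<lambda>h. h x) -` U"] exI[of _ "(\<lambda>h. h x) -` V"]) auto
qed

lemma continuous_on_evaluation: "continuous_on S (\<lambda>\<alpha>. \<alpha> a :: complex)"
  by (rule continuous_on_subset[OF continuous_on_product_coordinates]) simp

lemma (in star_algebra) closed_characters: "closed (characters scaleC star)"
proof -
  have "star_linear scaleC star \<alpha> \<longleftrightarrow> (\<forall>a b. \<alpha> (a + b) = \<alpha> a + \<alpha> b) \<and> (\<forall>c a. \<alpha> (scaleC c a) = c * \<alpha> a) \<and>
      (\<forall>a. \<alpha> (star a) = cnj (\<alpha> a))" for \<alpha>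
    using star_linearD(1,5,7)[of \<alpha>] star_linearI[of \<alpha>] by blast
  then have "characters scaleC star = {\<alpha>. (\<forall>a b. \<alpha> (a + b) = \<alpha> a + \<alpha> b) \<and> (\<forall>c a. \<alpha> (scaleC c a) = c * \<alpha> a) \<and>
      (\<forall>a. \<alpha> (star a) = cnj (\<alpha> a)) \<and> (\<forall>a b. \<alpha> (a * b) = \<alpha> a * \<alpha> b) \<and> \<alpha> 1 = 1}"
    unfolding characters_def by simp
  also have "closed \<dots>"
    by (intro closed_Collect_conj closed_Collect_all closed_Collect_eq continuous_intros continuous_on_evaluation)
  finally show ?thesis .
qed

context seminormed_star_algebra
begin

text \<open>The spectrum consists of the characters inside a product of discs, which is compact by Tychonoff's
theorem.\<close>

lemma compact_gelfand_spectrum: "compact (gelfand_spectrum scaleC star \<phi>)"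
proof -
  have "compactin (product_topology (\<lambda>_. euclidean) UNIV) (PiE UNIV (\<lambda>a. cball (0::complex) (\<phi> a)))"
    by (subst compactin_PiE) auto
  then have "compact (PiE UNIV (\<lambda>a. cball (0::complex) (\<phi> a)))"
    by (simp add: euclidean_product_topology)
  then have "compact (PiE UNIV (\<lambda>a. cball (0::complex) (\<phi> a)) \<inter> characters scaleC star)"
    by (rule compact_Int_closed[OF _ closed_characters])
  moreover have "PiE UNIV (\<lambda>a. cball (0::complex) (\<phi> a)) \<inter> characters scaleC star
      = gelfand_spectrum scaleC star \<phi>"
    unfolding gelfand_spectrum_eq by (auto simp: PiE_def Pi_def)
  ultimately show ?thesis by simp
qed

lemma compact_nonneg_spectrum: "compact (nonneg_characters scaleC star S \<inter> gelfand_spectrum scaleC star \<phi>)"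
proof -
  have "nonneg_characters scaleC star S \<inter> gelfand_spectrum scaleC star \<phi>
      = gelfand_spectrum scaleC star \<phi> \<inter> (\<Inter>s\<in>S. {\<alpha>. 0 \<le> Re (\<alpha> s)} \<inter> {\<alpha>. Im (\<alpha> s) = 0})"
    by (auto simp: nonneg_characters_def gelfand_spectrum_def complex_nonneg_Reals_iff)
  moreover have "closed (\<Inter>s\<in>S. {\<alpha>. 0 \<le> Re (\<alpha> s)} \<inter> {\<alpha>. Im (\<alpha> s) = 0})"
    by (intro closed_INT ballI closed_Int closed_Collect_eq closed_Collect_le
        continuous_intros continuous_on_evaluation)
  ultimately show ?thesis using compact_Int_closed[OF compact_gelfand_spectrum] by simp
qed

text \<open>Hermitian elements are real-valued on characters, so their Gelfand transforms form an algebra of real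
functions. They separate characters, since every element is a complex combination of two hermitian
elements.\<close>

lemma approximate_by_hermitian:
  assumes K: "K \<subseteq> characters scaleC star" "compact K" and f: "continuous_on K f" and e: "e > 0"
  obtains a where "a \<in> H" "\<And>\<alpha>. \<alpha> \<in> K \<Longrightarrow> \<bar>f \<alpha> - Re (\<alpha> a)\<bar> < e"
proof -
  \<comment> \<open>only the values on \<open>K\<close> count: off the characters, transforms are not closed under products\<close>
  define P where "P = {g. \<exists>a\<in>H. \<forall>\<alpha>\<in>K. g \<alpha> = Re (\<alpha> a)}"
  have lin: "star_linear scaleC star \<alpha>" and char: "\<alpha> \<in> characters scaleC star" if "\<alpha> \<in> K" for \<alpha>
    using that K(1) characterD(1) by blast+
  have real: "\<alpha> a = complex_of_real (Re (\<alpha> a))" if "\<alpha> \<in> K" "a \<in> H" for \<alpha> a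
    by (rule star_linearD(8)[OF lin[OF that(1)] that(2)])
  interpret function_ring_on P K
  proof
    show "compact K" by (rule K)
    show "continuous_on K g" if g: "g \<in> P" for g
    proof -
      obtain a where "\<forall>\<alpha>\<in>K. g \<alpha> = Re (\<alpha> a)" using g P_def by blast
      moreover have "continuous_on K (\<lambda>\<alpha>. Re (\<alpha> a))"
        by (intro continuous_intros continuous_on_evaluation)
      ultimately show ?thesis using continuous_on_cong by (metis (no_types, lifting))
    qed
    fix g h assume gh: "g \<in> P" "h \<in> P"
    then obtain a b where ab: "a \<in> H" "b \<in> H" "\<forall>\<alpha>\<in>K. g \<alpha> = Re (\<alpha> a)" "\<forall>\<alpha>\<in>K. h \<alpha> = Re (\<alpha> b)"
      unfolding P_def by blast
    have "g \<alpha> + h \<alpha> = Re (\<alpha> (a + b))" if \<alpha>: "\<alpha> \<in> K" for \<alpha>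
      using ab \<alpha> star_linearD(1)[OF lin[OF \<alpha>], of a b] by simp
    then show "(\<lambda>x. g x + h x) \<in> P" using ab unfolding P_def by blast
    have "g \<alpha> * h \<alpha> = Re (\<alpha> (a * b))" if \<alpha>: "\<alpha> \<in> K" for \<alpha>
    proof -
      have "Im (\<alpha> a) = 0" using real[OF \<alpha> ab(1)] by (metis Im_complex_of_real)
      then show ?thesis using ab \<alpha> characterD(2)[OF char[OF \<alpha>]] by simp
    qed
    then show "(\<lambda>x. g x * h x) \<in> P" using ab unfolding P_def by blast
  next
    fix c :: real
    have "c = Re (\<alpha> (c \<cdot> 1))" if \<alpha>: "\<alpha> \<in> K" for \<alpha>
      using star_linearD(6)[OF lin[OF \<alpha>], of c 1] characterD(3)[OF char[OF \<alpha>]] by simp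
    then show "(\<lambda>_. c) \<in> P" unfolding P_def by blast
  next
    fix \<alpha> \<beta> assume \<alpha>\<beta>: "\<alpha> \<in> K" "\<beta> \<in> K" "\<alpha> \<noteq> \<beta>"
    have "\<exists>a\<in>H. \<alpha> a \<noteq> \<beta> a"
    proof (rule ccontr)
      assume "\<not> ?thesis"
      then have same: "\<And>a. a \<in> H \<Longrightarrow> \<alpha> a = \<beta> a" by blast
      have "\<alpha> x = \<beta> x" for x
      proof -
        obtain h k where "h \<in> H" "k \<in> H" "x = h + scaleC \<i> k" by (rule cartesian_decomposition)
        then show ?thesis using same star_linearD(1,5)[OF lin[OF \<alpha>\<beta>(1)]] star_linearD(1,5)[OF lin[OF \<alpha>\<beta>(2)]] by simp
      qed
      then show False using \<alpha>\<beta>(3) by blast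
    qed
    then obtain a where a: "a \<in> H" "\<alpha> a \<noteq> \<beta> a" by blast
    then have "Re (\<alpha> a) \<noteq> Re (\<beta> a)" using real \<alpha>\<beta>(1,2) by metis
    moreover have "(\<lambda>\<alpha>. Re (\<alpha> a)) \<in> P" using a(1) unfolding P_def by blast
    ultimately show "\<exists>g\<in>P. g \<alpha> \<noteq> g \<beta>" by (intro bexI[of _ "\<lambda>\<alpha>. Re (\<alpha> a)"])
  qed
  obtain g where g: "g \<in> P" "\<forall>\<alpha>\<in>K. \<bar>f \<alpha> - g \<alpha>\<bar> < e" using Stone_Weierstrass_basic[OF f e] by blast
  then obtain a where "a \<in> H" "\<forall>\<alpha>\<in>K. g \<alpha> = Re (\<alpha> a)" unfolding P_def by blast
  with g(2) that show thesis by simp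
qed

end

section \<open>Representing measures\<close>

context seminormed_star_algebra
begin

abbreviation XR :: "('a \<Rightarrow> complex) set" where "XR \<equiv> characters scaleC star"
abbreviation CS :: "('a \<Rightarrow> complex) topology" where "CS \<equiv> character_space scaleC star"
abbreviation sp :: "('a \<Rightarrow> complex) set" where "sp \<equiv> gelfand_spectrum scaleC star \<phi>"

lemma topspace_CS: "topspace CS = XR"
  by (simp add: character_space_def)

lemma Hausdorff_CS: "Hausdorff_space CS"
  unfolding character_space_def by (intro Hausdorff_space_subtopology Hausdorff_space_euclidean_t2)

lemma openin_CS_I: "open U \<Longrightarrow> openin CS (XR \<inter> U)"
  by (simp add: character_space_def openin_open_Int)

lemma openin_CS_compl: "compact K \<Longrightarrow> openin CS (XR - K)"
  using openin_CS_I[of "- K"] by (simp add: compact_imp_closed open_Compl Diff_eq)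

lemma compactin_CS: "compactin CS F \<longleftrightarrow> compact F \<and> F \<subseteq> XR"
  by (simp add: character_space_def compactin_subtopology)

lemma radonD:
  assumes "radon_measure CS M"
  shows "space M = XR" "sets M = sigma_sets XR {U. openin CS U}" "openin CS U \<Longrightarrow> U \<in> sets M"
    "B \<in> sets M \<Longrightarrow> emeasure M B = (SUP K\<in>{K. compactin CS K \<and> K \<subseteq> B}. emeasure M K)"
  using assms by (auto simp: radon_measure_def topspace_CS)

lemma representing_measure:
  assumes M: "radon_measure CS M" and rep: "represents M L"
  shows "finite_measure M" "integrable M (\<lambda>\<alpha>. Re (\<alpha> a))" "(\<integral>\<alpha>. Re (\<alpha> a) \<partial>M) = Re (L a)"
    "measure M XR = Re (L 1)"
proof -
  have int: "integrable M (\<lambda>\<alpha>. \<alpha> a)" "L a = (\<integral>\<alpha>. \<alpha> a \<partial>M)" for a using rep by (auto simp: represents_def)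
  show Re: "integrable M (\<lambda>\<alpha>. Re (\<alpha> a))" "(\<integral>\<alpha>. Re (\<alpha> a) \<partial>M) = Re (L a)" for a
    using int[of a] by (simp_all add: integrable_Re)
  have one: "Re (\<alpha> 1) = 1" if "\<alpha> \<in> space M" for \<alpha>
    using that characterD(3)[of \<alpha>] by (simp add: radonD(1)[OF M])
  have "integrable M (\<lambda>_. 1::real) \<longleftrightarrow> integrable M (\<lambda>\<alpha>. Re (\<alpha> 1))"
    using one by (intro Bochner_Integration.integrable_cong) auto
  then have "integrable M (\<lambda>_. 1::real)" using Re(1) by blast
  then show fin: "finite_measure M"
    by (intro finite_measureI) (simp add: integrable_iff_bounded less_top)
  have "(\<integral>\<alpha>. Re (\<alpha> 1) \<partial>M) = (\<integral>\<alpha>. 1 \<partial>M)" using one by (intro Bochner_Integration.integral_cong) auto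
  then show "measure M XR = Re (L 1)" using Re(2)[of 1] by (simp add: radonD(1)[OF M])
qed

text \<open>Markov's inequality for high moments: the integral of \<open>(cmod (\<alpha> a))\<^sup>2\<^sup>n\<close> is the value of \<open>L\<close> at
\<open>(a * star a)\<^sup>n\<close>, hence at most \<open>C * (\<phi> a)\<^sup>2\<^sup>n\<close>. If \<open>\<phi> a < c\<close>, the resulting bound \<open>C * (\<phi> a / c)\<^sup>2\<^sup>n\<close> for the
measure of \<open>{\<alpha>. c < cmod (\<alpha> a)}\<close> tends to \<open>0\<close>.\<close>

lemma representing_measure_tail:
  assumes L: "star_linear scaleC star L" "\<And>a. cmod (L a) \<le> C * \<phi> a" "0 \<le> C"
    and M: "radon_measure CS M" "represents M L" and c: "\<phi> a < c"
  shows "emeasure M (XR \<inter> {\<alpha>. c < cmod (\<alpha> a)}) = 0"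
proof -
  define U where "U = XR \<inter> {\<alpha>. c < cmod (\<alpha> a)}"
  interpret finite_measure M by (rule representing_measure(1)[OF M])
  have "open {\<alpha>. c < cmod (\<alpha> a)}"
    by (intro open_Collect_less continuous_intros continuous_on_evaluation)
  then have Us: "U \<in> sets M" unfolding U_def by (intro radonD(3)[OF M(1)] openin_CS_I)
  have c0: "c > 0" using c seminorm_simps(1)[of a] by linarith
  define q where "q = (\<phi> a / c)\<^sup>2"
  have q: "0 \<le> q" "q < 1" using c c0 by (auto simp: q_def power_less_one_iff)
  have bound: "measure M U \<le> C * q ^ Suc n" for n
  proof -
    define b where "b = (a * star a) ^ Suc n"
    have b: "Re (\<alpha> b) = (cmod (\<alpha> a))\<^sup>2 ^ Suc n" if "\<alpha> \<in> XR" for \<alpha>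
    proof -
      have "\<alpha> b = complex_of_real ((cmod (\<alpha> a))\<^sup>2 ^ Suc n)"
        unfolding b_def characterD(4)[OF that] norm_sq_character[OF that] by (rule of_real_power[symmetric])
      then show ?thesis by simp
    qed
    have "c\<^sup>2 ^ Suc n * measure M U = (\<integral>\<alpha>. c\<^sup>2 ^ Suc n * indicator U \<alpha> \<partial>M)" using Us by simp
    also have "\<dots> \<le> (\<integral>\<alpha>. Re (\<alpha> b) \<partial>M)"
    proof (rule integral_mono)
      show "integrable M (\<lambda>\<alpha>. c\<^sup>2 ^ Suc n * indicator U \<alpha>)" using Us by (simp add: emeasure_eq_measure)
      show "integrable M (\<lambda>\<alpha>. Re (\<alpha> b))" by (rule representing_measure(2)[OF M])
      fix \<alpha> assume "\<alpha> \<in> space M"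
      then have \<alpha>: "\<alpha> \<in> XR" by (simp add: radonD(1)[OF M(1)])
      show "c\<^sup>2 ^ Suc n * indicator U \<alpha> \<le> Re (\<alpha> b)"
      proof (cases "\<alpha> \<in> U")
        case True
        then have "c\<^sup>2 ^ Suc n \<le> (cmod (\<alpha> a))\<^sup>2 ^ Suc n" using c0 by (intro power_mono) (auto simp: U_def)
        then show ?thesis using True unfolding b[OF \<alpha>] by simp
      next
        case False
        then show ?thesis unfolding b[OF \<alpha>] by simp
      qed
    qed
    also have "\<dots> = Re (L b)" by (rule representing_measure(3)[OF M])
    also have "\<dots> \<le> C * \<phi> b" using L(2)[of b] complex_Re_le_cmod order_trans by blast
    also have "\<dots> \<le> C * (\<phi> a)\<^sup>2 ^ Suc n"
    proof (intro mult_left_mono L(3))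
      have "\<phi> b \<le> \<phi> (a * star a) ^ Suc n" unfolding b_def by (rule seminorm_power)
      also have "\<dots> \<le> (\<phi> a)\<^sup>2 ^ Suc n"
        using seminorm_mult[of a "star a"] by (intro power_mono) (auto simp: power2_eq_square)
      finally show "\<phi> b \<le> (\<phi> a)\<^sup>2 ^ Suc n" .
    qed
    finally have "measure M U \<le> C * (\<phi> a)\<^sup>2 ^ Suc n / c\<^sup>2 ^ Suc n"
      using c0 by (subst pos_le_divide_eq) (auto simp: mult.commute)
    also have "\<dots> = C * q ^ Suc n" unfolding q_def by (simp only: power_divide times_divide_eq_right)
    finally show ?thesis .
  qed
  have "(\<lambda>n. C * q ^ Suc n) \<longlonglongrightarrow> C * 0"
    using q by (intro tendsto_mult tendsto_const LIMSEQ_Suc LIMSEQ_power_zero) auto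
  then have "measure M U \<le> C * 0" using bound by (intro LIMSEQ_le_const) auto
  then have "measure M U = 0" using measure_nonneg[of M U] by linarith
  then show ?thesis by (simp add: emeasure_eq_measure U_def)
qed

text \<open>The complement of the spectrum is a union of open null sets of the form treated in
\<open>representing_measure_tail\<close>. The union is uncountable in general, and inner regularity makes it null.\<close>

lemma null_off_spectrum:
  assumes L: "star_linear scaleC star L" "continuous_map (seminorm_topology \<phi>) euclidean L"
    and M: "radon_measure CS M" "represents M L"
  shows "emeasure M (XR - sp) = 0"
proof -
  obtain C where C: "C \<ge> 0" "\<And>a. cmod (L a) \<le> C * \<phi> a" using L continuous_iff_bounded by blast
  define \<U> where "\<U> = {XR \<inter> {\<alpha>. c < cmod (\<alpha> a)} |a c. \<phi> a < c}"
  have "XR - sp = \<Union>\<U>"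
  proof
    show "XR - sp \<subseteq> \<Union>\<U>"
    proof
      fix \<alpha> assume "\<alpha> \<in> XR - sp"
      then have \<alpha>: "\<alpha> \<in> XR" and "\<exists>a. \<phi> a < cmod (\<alpha> a)"
        unfolding gelfand_spectrum_eq by (auto simp: not_le)
      then obtain a c where "\<phi> a < c" "c < cmod (\<alpha> a)" using dense by blast
      with \<alpha> show "\<alpha> \<in> \<Union>\<U>" unfolding \<U>_def by blast
    qed
    show "\<Union>\<U> \<subseteq> XR - sp"
    proof
      fix \<alpha> assume "\<alpha> \<in> \<Union>\<U>"
      then obtain a c where "\<alpha> \<in> XR" "c < cmod (\<alpha> a)" "\<phi> a < c" unfolding \<U>_def by blast
      moreover from this have "\<not> cmod (\<alpha> a) \<le> \<phi> a" by linarith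
      ultimately show "\<alpha> \<in> XR - sp" unfolding gelfand_spectrum_eq by blast
    qed
  qed
  moreover have "emeasure M (\<Union>\<U>) = 0"
  proof (rule radon_null_Union[OF M(1)])
    fix U assume "U \<in> \<U>"
    then obtain a c where U: "U = XR \<inter> {\<alpha>. c < cmod (\<alpha> a)}" "\<phi> a < c" unfolding \<U>_def by blast
    show "openin CS U" unfolding U(1)
      by (intro openin_CS_I open_Collect_less continuous_intros continuous_on_evaluation)
    show "emeasure M U = 0" unfolding U(1) by (rule representing_measure_tail[OF L(1) C(2,1) M U(2)])
  qed
  ultimately show ?thesis by simp
qed

text \<open>Choose a compact \<open>G\<close> inside the complement of \<open>F\<close> that almost exhausts its \<open>N\<close>-measure, and a hermitian
\<open>a\<close> whose transform on \<open>K\<close> is within \<open>e\<close> of a Urysohn function that is \<open>1\<close> on \<open>F\<close> and \<open>0\<close> on \<open>G\<close>.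
Up to multiples of \<open>e\<close>, \<open>Re (L a)\<close> is then at least \<open>measure M F\<close> and at most the \<open>N\<close>-measure of the complement of
\<open>G\<close>, which is nearly \<open>measure N F\<close>.\<close>

lemma representing_measure_compact_le:
  assumes M: "radon_measure CS M" "represents M L" "emeasure M (XR - K) = 0"
    and N: "radon_measure CS N" "represents N L" "emeasure N (XR - K) = 0"
    and K: "compact K" "K \<subseteq> XR" and F: "compactin CS F"
  shows "emeasure M F \<le> emeasure N F"
proof -
  interpret M: finite_measure M by (rule representing_measure(1)[OF M(1,2)])
  interpret N: finite_measure N by (rule representing_measure(1)[OF N(1,2)])
  have setsMN: "sets N = sets M" by (simp add: radonD(2)[OF M(1)] radonD(2)[OF N(1)])
  have compl: "XR - G \<in> sets M" "G \<in> sets M" if "compactin CS G" for G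
  proof -
    show *: "XR - G \<in> sets M" using that by (intro radonD(3)[OF M(1)] openin_CS_compl) (simp add: compactin_CS)
    have "XR - (XR - G) = G" using that by (auto simp: compactin_CS)
    then show "G \<in> sets M" using sets.compl_sets[OF *] by (simp add: radonD(1)[OF M(1)])
  qed
  have KM: "XR - K \<in> sets M" by (intro radonD(3)[OF M(1)] openin_CS_compl K)
  have AE_M: "AE \<alpha> in M. \<alpha> \<in> K" and AE_N: "AE \<alpha> in N. \<alpha> \<in> K"
    using M(3) N(3) KM setsMN
    by (auto intro!: AE_I'[of "XR - K"] simp: null_sets_def radonD(1)[OF M(1)] radonD(1)[OF N(1)])
  have L1: "0 \<le> Re (L 1)" using representing_measure(4)[OF M(1,2)] by (metis measure_nonneg)
  have step: "measure M F \<le> measure N F + e * (1 + 2 * Re (L 1))" if e: "e > 0" for e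
  proof -
    have "\<exists>G\<in>{G. compactin CS G \<and> G \<subseteq> XR - F}. emeasure N (XR - F) < emeasure N G + ennreal e"
    proof (rule SUP_approx_ennreal[OF e _ radonD(4)[OF N(1)]])
      show "{G. compactin CS G \<and> G \<subseteq> XR - F} \<noteq> {}" by (auto intro: exI[of _ "{}"])
    qed (use compl(1)[OF F] setsMN in auto)
    then obtain G where G: "compactin CS G" "G \<subseteq> XR - F" "emeasure N (XR - F) < emeasure N G + ennreal e" by blast
    then have Gm: "measure N (XR - F) \<le> measure N G + e"
      using e by (simp add: N.emeasure_eq_measure ennreal_plus[symmetric] ennreal_less_iff del: ennreal_plus)
    have cF: "closed F" "closed G" using F G(1) by (auto simp: compactin_CS compact_imp_closed)
    have "normal_space (top_of_set K)"
      using K(1) by (intro compact_Hausdorff_or_regular_imp_normal_space disjI1 Hausdorff_space_subtopology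
          Hausdorff_space_euclidean_t2) (simp add: compact_space_subtopology)
    moreover have "closedin (top_of_set K) (K \<inter> G)" "closedin (top_of_set K) (K \<inter> F)"
      using cF by (auto intro: closedin_closed_Int)
    moreover have "disjnt (K \<inter> G) (K \<inter> F)" using G(2) by (auto simp: disjnt_def)
    ultimately obtain f where f: "continuous_map (top_of_set K) (top_of_set {0..1::real}) f"
      "f ` (K \<inter> G) \<subseteq> {0}" "f ` (K \<inter> F) \<subseteq> {1}"
      using Urysohn_lemma[of "top_of_set K" "K \<inter> G" "K \<inter> F" 0 1] by (metis zero_le_one)
    have fc: "continuous_on K f" and f01: "\<And>\<alpha>. \<alpha> \<in> K \<Longrightarrow> 0 \<le> f \<alpha> \<and> f \<alpha> \<le> 1"
      using f(1) by (auto simp: continuous_map_in_subtopology)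
    obtain a where a: "a \<in> H" "\<And>\<alpha>. \<alpha> \<in> K \<Longrightarrow> \<bar>f \<alpha> - Re (\<alpha> a)\<bar> < e"
      using approximate_by_hermitian[OF K(2,1) fc e] by blast
    have "measure M F = (\<integral>\<alpha>. indicator F \<alpha> \<partial>M)" using compl(2)[OF F] by simp
    also have "\<dots> \<le> (\<integral>\<alpha>. Re (\<alpha> a) + e \<partial>M)"
    proof (rule integral_mono_AE)
      show "integrable M (indicator F :: _ \<Rightarrow> real)" using compl(2)[OF F] by (simp add: M.emeasure_eq_measure)
      show "integrable M (\<lambda>\<alpha>. Re (\<alpha> a) + e)" using representing_measure(2)[OF M(1,2)] by simp
      show "AE \<alpha> in M. indicator F \<alpha> \<le> Re (\<alpha> a) + e"
        using AE_M
      proof eventually_elim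
        case (elim \<alpha>)
        then show ?case using a(2)[OF elim] f01[OF elim] f(3) by (auto simp: indicator_def)
      qed
    qed
    also have "\<dots> = Re (L a) + e * Re (L 1)"
      using representing_measure[OF M(1,2)] by (simp add: radonD(1)[OF M(1)])
    also have "Re (L a) = (\<integral>\<alpha>. Re (\<alpha> a) \<partial>N)" using representing_measure(3)[OF N(1,2)] by simp
    also have "\<dots> \<le> (\<integral>\<alpha>. indicator (XR - G) \<alpha> + e \<partial>N)"
    proof (rule integral_mono_AE)
      have Gs: "XR - G \<in> sets N" using compl(1)[OF G(1)] setsMN by simp
      show "integrable N (\<lambda>\<alpha>. indicator (XR - G) \<alpha> + e)" using Gs by (simp add: N.emeasure_eq_measure)
      show "integrable N (\<lambda>\<alpha>. Re (\<alpha> a))" by (rule representing_measure(2)[OF N(1,2)])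
      show "AE \<alpha> in N. Re (\<alpha> a) \<le> indicator (XR - G) \<alpha> + e"
        using AE_N
      proof eventually_elim
        case (elim \<alpha>)
        then show ?case using a(2)[OF elim] f01[OF elim] f(2) K(2) by (auto simp: indicator_def)
      qed
    qed
    also have "\<dots> = measure N (XR - G) + e * Re (L 1)"
      using representing_measure(4)[OF N(1,2)] compl(1)[OF G(1)] setsMN
      by (simp add: radonD(1)[OF N(1)] N.emeasure_eq_measure Int_absorb2)
    also have "measure N (XR - G) \<le> measure N F + e"
    proof -
      have "measure N (XR - G) = measure N XR - measure N G" "measure N (XR - F) = measure N XR - measure N F"
        using N.finite_measure_compl[of G] N.finite_measure_compl[of F] compl(2) F G(1) setsMN
        by (simp_all add: radonD(1)[OF N(1)])
      then show ?thesis using Gm by simp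
    qed
    finally show ?thesis by (simp add: algebra_simps)
  qed
  have "measure M F \<le> measure N F"
  proof (rule field_le_epsilon)
    fix e :: real assume "e > 0"
    then show "measure M F \<le> measure N F + e"
      using step[of "e / (1 + 2 * Re (L 1))"] L1 by (simp add: add_pos_nonneg)
  qed
  then show ?thesis by (simp add: M.emeasure_eq_measure N.emeasure_eq_measure)
qed

lemma representing_measure_unique:
  assumes M: "radon_measure CS M" "represents M L" "emeasure M (XR - K) = 0"
    and N: "radon_measure CS N" "represents N L" "emeasure N (XR - K) = 0"
    and K: "compact K" "K \<subseteq> XR"
  shows "M = N"
proof (rule measure_eqI)
  show setsMN: "sets M = sets N" by (simp add: radonD(2)[OF M(1)] radonD(2)[OF N(1)])
  fix B assume B: "B \<in> sets M"
  have "emeasure M F = emeasure N F" if "compactin CS F" for F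
    using representing_measure_compact_le[OF M N K that] representing_measure_compact_le[OF N M K that] by simp
  then have "(SUP F\<in>{F. compactin CS F \<and> F \<subseteq> B}. emeasure M F) = (SUP F\<in>{F. compactin CS F \<and> F \<subseteq> B}. emeasure N F)"
    by (intro SUP_cong) auto
  then show "emeasure M B = emeasure N B"
    using radonD(4)[OF M(1) B] radonD(4)[OF N(1), of B] B setsMN by simp
qed

text \<open>The hypothesis makes \<open>Re (L a)\<close> monotone in the transform of \<open>a\<close> on \<open>K\<close>. By density of the transforms it
extends to a positive functional on the continuous functions on \<open>K\<close>. The Riesz measure of this
functional is then transported to the character space along the inclusion of \<open>K\<close>.\<close>

lemma exists_representing_measure:
  assumes L: "star_linear scaleC star L" and K: "compact K" "K \<subseteq> XR"
    and pos: "\<And>a. a \<in> H \<Longrightarrow> (\<And>\<alpha>. \<alpha> \<in> K \<Longrightarrow> 0 \<le> Re (\<alpha> a)) \<Longrightarrow> 0 \<le> Re (L a)"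
  obtains M where "radon_measure CS M" "represents M L" "emeasure M (XR - K) = 0"
proof -
  note linL = star_linearD(1-7)[OF L]
  define m where "m = Re (L 1)"
  have linK: "Re (\<alpha> (a + b)) = Re (\<alpha> a) + Re (\<alpha> b)" "Re (\<alpha> (a - b)) = Re (\<alpha> a) - Re (\<alpha> b)"
    "Re (\<alpha> (r \<cdot> a)) = r * Re (\<alpha> a)" "Re (\<alpha> 1) = 1"
    if "\<alpha> \<in> K" for \<alpha> a b r
  proof -
    have "\<alpha> \<in> XR" using that K(2) by blast
    from star_linearD[OF characterD(1)[OF this]] characterD(3)[OF this]
    show "Re (\<alpha> (a + b)) = Re (\<alpha> a) + Re (\<alpha> b)" "Re (\<alpha> (a - b)) = Re (\<alpha> a) - Re (\<alpha> b)"
      "Re (\<alpha> (r \<cdot> a)) = r * Re (\<alpha> a)" "Re (\<alpha> 1) = 1" by simp_all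
  qed
  have m: "0 \<le> m" unfolding m_def using linK(4) by (intro pos) auto
  have lower: "Re (L b) - e * m \<le> Re (L a)"
    if "a \<in> H" "b \<in> H" "\<And>\<alpha>. \<alpha> \<in> K \<Longrightarrow> Re (\<alpha> b) - e \<le> Re (\<alpha> a)" for a b e
  proof -
    have "0 \<le> Re (L (a - b + e \<cdot> 1))"
    proof (rule pos)
      show "a - b + e \<cdot> 1 \<in> H" using that(1,2) by auto
      show "0 \<le> Re (\<alpha> (a - b + e \<cdot> 1))" if "\<alpha> \<in> K" for \<alpha>
        using \<open>\<And>\<alpha>. \<alpha> \<in> K \<Longrightarrow> Re (\<alpha> b) - e \<le> Re (\<alpha> a)\<close>[OF that] by (simp add: linK[OF that])
    qed
    then show ?thesis by (simp add: linL m_def)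
  qed
  \<comment> \<open>by the estimate \<open>\<Lambda>\<close> below, this is the limit of \<open>Re (L a)\<close> as the transform of \<open>a\<close> approaches \<open>f\<close>\<close>
  define \<Lambda> where "\<Lambda> f = Inf {Re (L a) |a. a \<in> H \<and> (\<forall>\<alpha>\<in>K. f \<alpha> \<le> Re (\<alpha> a))}" for f
  have \<Lambda>: "\<bar>\<Lambda> f - Re (L a)\<bar> \<le> e * m"
    if a: "a \<in> H" "\<And>\<alpha>. \<alpha> \<in> K \<Longrightarrow> \<bar>f \<alpha> - Re (\<alpha> a)\<bar> \<le> e" for f a e
  proof -
    let ?A = "{Re (L a) |a. a \<in> H \<and> (\<forall>\<alpha>\<in>K. f \<alpha> \<le> Re (\<alpha> a))}"
    have le: "f \<alpha> \<le> Re (\<alpha> a) + e" "Re (\<alpha> a) - e \<le> f \<alpha>" if "\<alpha> \<in> K" for \<alpha> using a(2)[OF that] by linarith+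
    have lb: "Re (L a) - e * m \<le> x" if "x \<in> ?A" for x
    proof -
      obtain b where b: "x = Re (L b)" "b \<in> H" "\<forall>\<alpha>\<in>K. f \<alpha> \<le> Re (\<alpha> b)" using \<open>x \<in> ?A\<close> by blast
      show ?thesis unfolding b(1) using le(2) b(3) by (intro lower a(1) b(2)) force
    qed
    have "a + e \<cdot> 1 \<in> H" "\<forall>\<alpha>\<in>K. f \<alpha> \<le> Re (\<alpha> (a + e \<cdot> 1))" using a(1) le(1) by (auto simp: linK)
    then have mem: "Re (L (a + e \<cdot> 1)) \<in> ?A" by blast
    have "\<Lambda> f \<le> Re (L (a + e \<cdot> 1))"
      unfolding \<Lambda>_def by (rule cInf_lower[OF mem]) (use lb in \<open>auto intro!: bdd_belowI\<close>)
    moreover have "Re (L a) - e * m \<le> \<Lambda> f"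
      unfolding \<Lambda>_def using mem lb by (intro cInf_greatest) blast+
    ultimately show ?thesis by (simp add: linL m_def abs_le_iff)
  qed
  \<comment> \<open>identities for \<open>\<Lambda>\<close> hold up to multiples of \<open>e * m\<close> and become exact as \<open>e\<close> tends to \<open>0\<close>\<close>
  have small: "x \<le> 0" if "\<And>e. e > 0 \<Longrightarrow> x \<le> k * (e * m)" "0 \<le> k" for x k
  proof (rule field_le_epsilon)
    fix e :: real assume e: "e > 0"
    have pos: "k * m + 1 > 0" using that(2) m by (simp add: add_nonneg_pos)
    have "x \<le> k * (e / (k * m + 1) * m)" using e pos by (intro that(1)) simp
    also have "\<dots> \<le> e" using e pos by (simp add: field_simps)
    finally show "x \<le> 0 + e" by simp
  qed
  interpret positive_functional "top_of_set K" \<Lambda>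
  proof
    show "compact_space (top_of_set K)" using K(1) by (simp add: compact_space_subtopology)
    show "Hausdorff_space (top_of_set K)" by (intro Hausdorff_space_subtopology Hausdorff_space_euclidean_t2)
    fix f :: "('a \<Rightarrow> complex) \<Rightarrow> real" assume "continuous_map (top_of_set K) euclideanreal f"
    then have fc: "continuous_on K f" by simp
    note approx = approximate_by_hermitian[OF K(2,1)]
    show "\<Lambda> (\<lambda>x. f x + g x) = \<Lambda> f + \<Lambda> g" if "continuous_map (top_of_set K) euclideanreal g" for g
    proof -
      have gc: "continuous_on K g" using that by simp
      have "\<bar>\<Lambda> (\<lambda>x. f x + g x) - (\<Lambda> f + \<Lambda> g)\<bar> \<le> 4 * (e * m)" if e: "e > 0" for e
      proof -
        obtain a where a: "a \<in> H" "\<And>\<alpha>. \<alpha> \<in> K \<Longrightarrow> \<bar>f \<alpha> - Re (\<alpha> a)\<bar> < e" using approx[OF fc e] by blast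
        obtain b where b: "b \<in> H" "\<And>\<alpha>. \<alpha> \<in> K \<Longrightarrow> \<bar>g \<alpha> - Re (\<alpha> b)\<bar> < e" using approx[OF gc e] by blast
        have "\<bar>\<Lambda> (\<lambda>x. f x + g x) - Re (L (a + b))\<bar> \<le> (2 * e) * m"
          using a(1) b(1)
        proof (intro \<Lambda>)
          show "\<bar>f \<alpha> + g \<alpha> - Re (\<alpha> (a + b))\<bar> \<le> 2 * e" if "\<alpha> \<in> K" for \<alpha>
            using a(2)[OF that] b(2)[OF that] linK(1)[OF that, of a b] by linarith
        qed auto
        moreover have "\<bar>\<Lambda> f - Re (L a)\<bar> \<le> e * m" using a by (intro \<Lambda>) (auto intro: less_imp_le)
        moreover have "\<bar>\<Lambda> g - Re (L b)\<bar> \<le> e * m" using b by (intro \<Lambda>) (auto intro: less_imp_le)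
        moreover have "Re (L (a + b)) = Re (L a) + Re (L b)" by (simp add: linL)
        ultimately show ?thesis by linarith
      qed
      from small[OF this] show ?thesis by simp
    qed
    show "\<Lambda> (\<lambda>x. c * f x) = c * \<Lambda> f" for c
    proof -
      have "\<bar>\<Lambda> (\<lambda>x. c * f x) - c * \<Lambda> f\<bar> \<le> (2 * \<bar>c\<bar>) * (e * m)" if e: "e > 0" for e
      proof -
        obtain a where a: "a \<in> H" "\<And>\<alpha>. \<alpha> \<in> K \<Longrightarrow> \<bar>f \<alpha> - Re (\<alpha> a)\<bar> < e" using approx[OF fc e] by blast
        have "\<bar>\<Lambda> (\<lambda>x. c * f x) - Re (L (c \<cdot> a))\<bar> \<le> (\<bar>c\<bar> * e) * m"
          using a(1)
        proof (intro \<Lambda>)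
          show "\<bar>c * f \<alpha> - Re (\<alpha> (c \<cdot> a))\<bar> \<le> \<bar>c\<bar> * e" if "\<alpha> \<in> K" for \<alpha>
          proof -
            have "\<bar>c * f \<alpha> - Re (\<alpha> (c \<cdot> a))\<bar> = \<bar>c\<bar> * \<bar>f \<alpha> - Re (\<alpha> a)\<bar>"
              by (simp add: linK(3)[OF that] abs_mult[symmetric] right_diff_distrib)
            then show ?thesis using a(2)[OF that] by (simp add: mult_left_mono)
          qed
        qed auto
        moreover have "\<bar>c * \<Lambda> f - c * Re (L a)\<bar> \<le> \<bar>c\<bar> * (e * m)"
        proof -
          have "\<bar>\<Lambda> f - Re (L a)\<bar> \<le> e * m" using a by (intro \<Lambda>) (auto intro: less_imp_le)
          then have "\<bar>c\<bar> * \<bar>\<Lambda> f - Re (L a)\<bar> \<le> \<bar>c\<bar> * (e * m)" by (intro mult_left_mono) auto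
          then show ?thesis by (simp add: abs_mult[symmetric] right_diff_distrib)
        qed
        moreover have "Re (L (c \<cdot> a)) = c * Re (L a)" by (simp add: linL)
        ultimately show ?thesis by (simp add: mult.assoc)
      qed
      from small[OF this] show ?thesis by simp
    qed
    show "0 \<le> \<Lambda> f" if nonneg: "\<And>x. x \<in> topspace (top_of_set K) \<Longrightarrow> 0 \<le> f x"
    proof -
      have "- \<Lambda> f \<le> 2 * (e * m)" if e: "e > 0" for e
      proof -
        obtain a where a: "a \<in> H" "\<And>\<alpha>. \<alpha> \<in> K \<Longrightarrow> \<bar>f \<alpha> - Re (\<alpha> a)\<bar> < e" using approx[OF fc e] by blast
        have "Re (L 0) - e * m \<le> Re (L a)"
        proof (rule lower[OF a(1)])
          fix \<alpha> assume \<alpha>: "\<alpha> \<in> K"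
          have "Re (\<alpha> 0) = 0" using linK(3)[OF \<alpha>, of 0 0] by simp
          then show "Re (\<alpha> 0) - e \<le> Re (\<alpha> a)" using a(2)[OF \<alpha>] nonneg[of \<alpha>] \<alpha> by (simp add: abs_less_iff)
        qed simp
        moreover have "\<bar>\<Lambda> f - Re (L a)\<bar> \<le> e * m" using a by (intro \<Lambda>) (auto intro: less_imp_le)
        ultimately show ?thesis using linL(3) by simp
      qed
      from small[OF this] show ?thesis by simp
    qed
  qed
  let ?\<Sigma> = "sigma (topspace CS) {U. openin CS U}"
  define M where "M = distr riesz_measure ?\<Sigma> (\<lambda>\<alpha>. \<alpha>)"
  have sub: "subtopology CS K = top_of_set K"
    using K(2) by (simp add: character_space_def subtopology_subtopology Int_absorb1)
  have KX: "closedin CS K" using K openin_CS_compl by (auto simp: closedin_def topspace_CS)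
  note push = radon_push_forward[OF Hausdorff_CS KX, unfolded sub, OF radon_riesz finite_riesz, folded M_def]
  have M: "radon_measure CS M" "emeasure M (XR - K) = 0" using push(1,2) by (simp_all add: topspace_CS)
  have herm: "integrable M (\<lambda>\<alpha>. \<alpha> a) \<and> L a = (\<integral>\<alpha>. \<alpha> a \<partial>M)" if a: "a \<in> H" for a
  proof -
    have cm: "continuous_map CS euclideanreal (\<lambda>\<alpha>. Re (\<alpha> a))"
      unfolding character_space_def by (simp, intro continuous_intros continuous_on_evaluation)
    have Pow: "{U. openin CS U} \<subseteq> Pow (topspace CS)" using openin_subset by blast
    have meas: "(\<lambda>\<alpha>. Re (\<alpha> a)) \<in> borel_measurable ?\<Sigma>"
      by (rule continuous_map_borel_measurable[OF _ _ cm]) (simp_all add: Pow space_measure_of sets_measure_of)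
    have cK: "continuous_map (top_of_set K) euclideanreal (\<lambda>\<alpha>. Re (\<alpha> a))"
      by (simp, intro continuous_intros continuous_on_evaluation)
    have real: "integrable M (\<lambda>\<alpha>. Re (\<alpha> a))" "(\<integral>\<alpha>. Re (\<alpha> a) \<partial>M) = \<Lambda> (\<lambda>\<alpha>. Re (\<alpha> a))"
      unfolding M_def integrable_distr_eq[OF push(3) meas] integral_distr[OF push(3) meas]
      using integrable_riesz[OF cK] integral_riesz[OF cK] by auto
    have "\<Lambda> (\<lambda>\<alpha>. Re (\<alpha> a)) = Re (L a)" using \<Lambda>[OF a, of "\<lambda>\<alpha>. Re (\<alpha> a)" 0] by simp
    then have La: "L a = complex_of_real (\<integral>\<alpha>. Re (\<alpha> a) \<partial>M)" using real(2) star_linearD(8)[OF L a] by simp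
    have eq: "\<alpha> a = complex_of_real (Re (\<alpha> a))" if "\<alpha> \<in> space M" for \<alpha>
      using that star_linearD(8)[OF characterD(1) a] by (simp add: radonD(1)[OF M(1)])
    have "integrable M (\<lambda>\<alpha>. \<alpha> a) \<longleftrightarrow> integrable M (\<lambda>\<alpha>. complex_of_real (Re (\<alpha> a)))"
      using eq by (intro Bochner_Integration.integrable_cong) auto
    moreover have "(\<integral>\<alpha>. \<alpha> a \<partial>M) = (\<integral>\<alpha>. complex_of_real (Re (\<alpha> a)) \<partial>M)"
      using eq by (intro Bochner_Integration.integral_cong) auto
    ultimately show ?thesis using real(1) La by simp
  qed
  have "represents M L"
    unfolding represents_def
  proof
    fix a
    obtain h k where a: "h \<in> H" "k \<in> H" "a = h + scaleC \<i> k" by (rule cartesian_decomposition)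
    have eq: "\<alpha> a = \<alpha> h + \<i> * \<alpha> k" if "\<alpha> \<in> space M" for \<alpha>
      using that star_linearD(1,5)[OF characterD(1)] by (simp add: radonD(1)[OF M(1)] a(3))
    have "integrable M (\<lambda>\<alpha>. \<alpha> a) \<longleftrightarrow> integrable M (\<lambda>\<alpha>. \<alpha> h + \<i> * \<alpha> k)"
      using eq by (intro Bochner_Integration.integrable_cong) auto
    moreover have "(\<integral>\<alpha>. \<alpha> a \<partial>M) = (\<integral>\<alpha>. \<alpha> h + \<i> * \<alpha> k \<partial>M)"
      using eq by (intro Bochner_Integration.integral_cong) auto
    ultimately show "integrable M (\<lambda>\<alpha>. \<alpha> a) \<and> L a = (\<integral>\<alpha>. \<alpha> a \<partial>M)"
      using herm[OF a(1)] herm[OF a(2)] by (simp add: a(3) linL)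
  qed
  with M that show thesis by blast
qed

end

section \<open>The closure and the moment problem\<close>

theorem corollary4p1:
  fixes scaleC :: "complex \<Rightarrow> 'a::{comm_ring, comm_monoid_mult} \<Rightarrow> 'a"
    and star :: "'a \<Rightarrow> 'a"
    and \<phi> :: "'a \<Rightarrow> real"
    and d :: nat
    and S :: "'a set"
  assumes "star_algebra scaleC star"
    and "submult_star_seminorm scaleC star \<phi>"
    and "d \<ge> 1"
    and "power_module star d S"
  shows "subtopology (seminorm_topology \<phi>) (hermitian star) closure_of S =
           Pos star (nonneg_characters scaleC star S \<inter> gelfand_spectrum scaleC star \<phi>) \<and>
         (\<forall>L. star_linear scaleC star L \<and>
              continuous_map (seminorm_topology \<phi>) euclidean L \<and>
              (\<forall>s\<in>S. L s \<in> \<real>\<^sub>\<ge>\<^sub>0) \<longrightarrow>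
           (\<exists>!\<mu>. radon_measure (character_space scaleC star) \<mu> \<and> represents \<mu> L) \<and>
           (\<forall>\<mu>. radon_measure (character_space scaleC star) \<mu> \<and> represents \<mu> L \<longrightarrow>
              measure_support (character_space scaleC star) \<mu>
                \<subseteq> nonneg_characters scaleC star S \<inter> gelfand_spectrum scaleC star \<phi>))"
proof -
  interpret star_algebra scaleC star by (rule assms(1))
  interpret seminormed_star_algebra scaleC star \<phi> by unfold_locales (rule assms(2))
  let ?K = "nonneg_characters scaleC star S \<inter> sp"
  have K: "compact ?K" "?K \<subseteq> XR"
    using compact_nonneg_spectrum by (auto simp: nonneg_characters_def)
  have sp: "compact sp" "sp \<subseteq> XR"
    using compact_gelfand_spectrum by (auto simp: gelfand_spectrum_def)
  have SH: "S \<subseteq> H" using assms(4) by (simp add: power_module_def)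
  note closure = herm_closure_eq_Pos[OF assms(3,4)]
  have "(\<exists>!\<mu>. radon_measure CS \<mu> \<and> represents \<mu> L) \<and>
      (\<forall>\<mu>. radon_measure CS \<mu> \<and> represents \<mu> L \<longrightarrow> measure_support CS \<mu> \<subseteq> ?K)"
    if L: "star_linear scaleC star L" "continuous_map (seminorm_topology \<phi>) euclidean L"
      and nonneg: "\<forall>s\<in>S. L s \<in> \<real>\<^sub>\<ge>\<^sub>0" for L
  proof -
    have pos: "0 \<le> Re (L a)" if a: "a \<in> H" "\<And>\<alpha>. \<alpha> \<in> ?K \<Longrightarrow> 0 \<le> Re (\<alpha> a)" for a
    proof (rule continuous_nonneg_on_closure[OF L])
      show "L s \<in> \<real>\<^sub>\<ge>\<^sub>0" if "s \<in> S" for s using nonneg that by blast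
      have "\<alpha> a \<in> \<real>\<^sub>\<ge>\<^sub>0" if "\<alpha> \<in> ?K" for \<alpha>
      proof -
        have "\<alpha> \<in> XR" using that K(2) by blast
        then show ?thesis using star_linear_nonneg_iff[OF characterD(1) a(1)] a(2)[OF that] by blast
      qed
      then show "a \<in> herm_closure S" unfolding closure using a(1) by (simp add: Pos_def)
    qed
    obtain M where M: "radon_measure CS M" "represents M L" "emeasure M (XR - ?K) = 0"
      using exists_representing_measure[OF L(1) K pos] by blast
    have unique: "N = M" if "radon_measure CS N" "represents N L" for N
      using representing_measure_unique[OF that null_off_spectrum[OF L that] M(1,2)
          null_off_spectrum[OF L M(1,2)] sp] .
    have "measure_support CS M \<subseteq> ?K"
      using openin_CS_compl[OF K(1)] M(3) by (intro support_subset) (simp_all add: topspace_CS)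
    with M unique show ?thesis by blast
  qed
  then show ?thesis using herm_closure_eq[OF SH] closure by blast
qed

end
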